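(* Consider the linear system with three input delays $$\dot x(t)=Ax(t)+B_1u(t-\tau_1)+B_2u(t-\tau_2)+B_3u(t-\tau_3),$$ where $A\in\mathbf{R}^{n\times n}$, $B_i\in\mathbf{R}^{n\times m}$ ($i=1,2,3$) are constant matrices and $0\le\tau_1\le\tau_2\le\tau_3<\infty$ are constants. Let $\tau=\tau_1+\tau_2+\tau_3$, $B=\mathrm{e}^{-A\tau_1}B_1+\mathrm{e}^{-A\tau_2}B_2+\mathrm{e}^{-A\tau_3}B_3$, assume that $(A,B)$ is stabilizable, and let $F\in\mathbf{R}^{m\times n}$ be such that $A+BF$ is Hurwitz. Then the closed-loop system consisting of the linear system $\dot x(t)=Ax(t)+B_1u(t-\tau_1)+B_2u(t-\tau_2)+B_3u(t-\tau_3)$ and the pseudo-predictor feedback $$u(t)=F\mathrm{e}^{(A+BF)\tau}\mathrm{e}^{-A\tau}\bigl(x(t)-\varphi(t)\bigr),\qquad \varphi(t)=\sum_{i=1}^{3}\int_{t-\tau}^{t-\tau_i}\mathrm{e}^{A(t-s-\tau_i)}B_iu(s)\,\mathrm{d}s,$$ is asymptotically stable if and only if the integral delay system $$\rho(t)=-F\int_{t-\tau}^{t}\mathrm{e}^{(A+BF)(t-s)}B\rho(s)\,\mathrm{d}s$$ is asymptotically stable.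
   Context: A square matrix is Hurwitz if all its eigenvalues have negative real part. Asymptotic stability of the closed-loop system and of the integral delay system is meant in the usual sense for time-delay systems (functional differential/integral equations), with initial data given by functions on a past time interval. *)

theory Defs
  imports "HOL-Analysis.Analysis"
begin

text \<open>The multiplication \<open>*\<close> on \<open>real ^ 'n ^ 'n\<close> is componentwise, so the library
  functions \<open>^\<close> and \<open>exp\<close> cannot serve as matrix power and matrix exponential.\<close>

definition mexp :: "real ^ 'n ^ 'n \<Rightarrow> real ^ 'n ^ 'n" where
  "mexp A = (\<Sum>k. (1 / fact k) *\<^sub>R ((\<lambda>M. A ** M) ^^ k) (mat 1))"

definition is_eigenvalue :: "complex ^ 'n ^ 'n \<Rightarrow> complex \<Rightarrow> bool" where
  "is_eigenvalue A z \<longleftrightarrow> (\<exists>v. v \<noteq> 0 \<and> A *v v = z *s v)"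

definition hurwitz :: "real ^ 'n ^ 'n \<Rightarrow> bool" where
  "hurwitz A \<longleftrightarrow> (\<forall>z. is_eigenvalue (map_matrix complex_of_real A) z \<longrightarrow> Re z < 0)"

definition stabilizable :: "real ^ 'n ^ 'n \<Rightarrow> real ^ 'm ^ 'n \<Rightarrow> bool" where
  "stabilizable A B \<longleftrightarrow> (\<exists>K :: real ^ 'n ^ 'm. hurwitz (A + B ** K))"

definition piecewise_continuous_on :: "real \<Rightarrow> real \<Rightarrow> (real \<Rightarrow> 'a :: topological_space) \<Rightarrow> bool" where
  "piecewise_continuous_on a b f \<longleftrightarrow>
     (\<exists>D. finite D \<and> continuous_on ({a..b} - D) f) \<and>
     (\<forall>t. a < t \<and> t \<le> b \<longrightarrow> (\<exists>l. (f \<longlongrightarrow> l) (at_left t))) \<and>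
     (\<forall>t. a \<le> t \<and> t < b \<longrightarrow> (\<exists>l. (f \<longlongrightarrow> l) (at_right t)))"

text \<open>Throughout, \<open>Bi i\<close> and \<open>h i\<close> (\<open>i = 1, 2, 3\<close>) are the input matrices and the delays, and
  \<open>T\<close> is the total delay.\<close>

definition predictor_term ::
  "real ^ 'n ^ 'n \<Rightarrow> (nat \<Rightarrow> real ^ 'm ^ 'n) \<Rightarrow> (nat \<Rightarrow> real) \<Rightarrow> real \<Rightarrow> (real \<Rightarrow> real ^ 'm) \<Rightarrow> real \<Rightarrow> real ^ 'n"
where
  "predictor_term A Bi h T u t =
     (\<Sum>i=1..3. integral {t - T..t - h i} (\<lambda>s. mexp ((t - s - h i) *\<^sub>R A) *v (Bi i *v u s)))"

text \<open>Solutions on \<open>[0, \<infinity>)\<close>. The initial data are \<open>x 0\<close> and the piecewise continuous input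
  history of \<open>u\<close> on \<open>[-T, 0)\<close>; values of \<open>x\<close> before \<open>0\<close> and of \<open>u\<close> before \<open>-T\<close> play no role.
  As the history may jump, and \<open>u\<close> may jump at \<open>0\<close>, the differential equation
  is required only off an exceptional set \<open>D\<close> that is finite on bounded intervals, together with
  continuity of \<open>x\<close>.\<close>

definition closed_loop_solution ::
  "real ^ 'n ^ 'n \<Rightarrow> (nat \<Rightarrow> real ^ 'm ^ 'n) \<Rightarrow> (nat \<Rightarrow> real) \<Rightarrow> real \<Rightarrow> real ^ 'm ^ 'n \<Rightarrow> real ^ 'n ^ 'm \<Rightarrow>
   (real \<Rightarrow> real ^ 'n) \<Rightarrow> (real \<Rightarrow> real ^ 'm) \<Rightarrow> bool"
where
  "closed_loop_solution A Bi h T B F x u \<longleftrightarrow>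
     continuous_on {0..} x \<and>
     (\<forall>b\<ge>0. piecewise_continuous_on (- T) b u) \<and>
     (\<exists>D. (\<forall>b. finite (D \<inter> {0..b})) \<and>
        (\<forall>t\<in>{0..} - D.
           (x has_vector_derivative (A *v x t + (\<Sum>i=1..3. Bi i *v u (t - h i)))) (at t within {0..}))) \<and>
     (\<forall>t\<ge>0. u t = (F ** mexp (T *\<^sub>R (A + B ** F)) ** mexp (- T *\<^sub>R A)) *v
                     (x t - predictor_term A Bi h T u t))"

text \<open>The state of the closed loop at time \<open>t\<close> consists of \<open>x t\<close> and the segment of \<open>u\<close> on
  \<open>[t - T, t)\<close>, with the supremum norm on segments. Asymptotic stability is Lyapunov stability
  together with local attractivity.\<close>

definition closed_loop_asymptotically_stable ::
  "real ^ 'n ^ 'n \<Rightarrow> (nat \<Rightarrow> real ^ 'm ^ 'n) \<Rightarrow> (nat \<Rightarrow> real) \<Rightarrow> real \<Rightarrow> real ^ 'm ^ 'n \<Rightarrow> real ^ 'n ^ 'm \<Rightarrow> bool"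
where
  "closed_loop_asymptotically_stable A Bi h T B F \<longleftrightarrow>
     (\<forall>\<epsilon>>0. \<exists>\<delta>>0. \<forall>x u. closed_loop_solution A Bi h T B F x u \<and>
         norm (x 0) < \<delta> \<and> (\<forall>\<theta>\<in>{- T..<0}. norm (u \<theta>) < \<delta>) \<longrightarrow>
         (\<forall>t\<ge>0. norm (x t) < \<epsilon> \<and> norm (u t) < \<epsilon>)) \<and>
     (\<exists>\<delta>>0. \<forall>x u. closed_loop_solution A Bi h T B F x u \<and>
         norm (x 0) < \<delta> \<and> (\<forall>\<theta>\<in>{- T..<0}. norm (u \<theta>) < \<delta>) \<longrightarrow>
         (x \<longlongrightarrow> 0) at_top \<and> (u \<longlongrightarrow> 0) at_top)"

definition integral_delay_solution ::
  "real ^ 'n ^ 'n \<Rightarrow> real \<Rightarrow> real ^ 'm ^ 'n \<Rightarrow> real ^ 'n ^ 'm \<Rightarrow> (real \<Rightarrow> real ^ 'm) \<Rightarrow> bool"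
where
  "integral_delay_solution A T B F \<rho> \<longleftrightarrow>
     (\<forall>b\<ge>0. piecewise_continuous_on (- T) b \<rho>) \<and>
     (\<forall>t\<ge>0. \<rho> t = - (F *v integral {t - T..t} (\<lambda>s. mexp ((t - s) *\<^sub>R (A + B ** F)) *v (B *v \<rho> s))))"

definition integral_delay_asymptotically_stable ::
  "real ^ 'n ^ 'n \<Rightarrow> real \<Rightarrow> real ^ 'm ^ 'n \<Rightarrow> real ^ 'n ^ 'm \<Rightarrow> bool"
where
  "integral_delay_asymptotically_stable A T B F \<longleftrightarrow>
     (\<forall>\<epsilon>>0. \<exists>\<delta>>0. \<forall>\<rho>. integral_delay_solution A T B F \<rho> \<and>
         (\<forall>\<theta>\<in>{- T..<0}. norm (\<rho> \<theta>) < \<delta>) \<longrightarrow> (\<forall>t\<ge>0. norm (\<rho> t) < \<epsilon>)) \<and>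
     (\<exists>\<delta>>0. \<forall>\<rho>. integral_delay_solution A T B F \<rho> \<and>
         (\<forall>\<theta>\<in>{- T..<0}. norm (\<rho> \<theta>) < \<delta>) \<longrightarrow> (\<rho> \<longlongrightarrow> 0) at_top)"

end

theory Submission
  imports Defs "HOL-Computational_Algebra.Fundamental_Theorem_Algebra"
begin

text \<open>Put \<open>z(t) = e\<^sup>-\<^sup>A\<^sup>T (x(t) - \<phi>(t))\<close>. Differentiating \<open>\<phi>\<close> gives \<open>z' = A z + B u(t - T)\<close>, and the
  feedback reads \<open>u(t) = F e\<^sup>G\<^sup>T z(t)\<close> with \<open>G = A + B F\<close>. With the residual
  \<open>\<rho>(t) = u(t) - F z(t + T)\<close> the equation becomes \<open>z' = G z + B \<rho>(t - T)\<close>, and variation of constants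
  over a window of length \<open>T\<close> turns the feedback law into the integral delay equation for \<open>\<rho>\<close>.
  Conversely, a solution \<open>\<rho>\<close> of that equation determines \<open>z\<close> with \<open>z(0) = 0\<close>, and then
  \<open>u\<close> and \<open>x\<close>. Since \<open>G\<close> is Hurwitz, smallness and decay pass between \<open>\<rho>\<close> and \<open>(x, u)\<close> in both
  directions.\<close>

section \<open>The matrix exponential\<close>

text \<open>The purpose of \<phi> is to give all inputs one common delay: its derivative cancels
  each \<open>u(t - h i)\<close> and leaves a single \<open>u(t - T)\<close> with matrix
  \<open>e^(A T) B\<close>, which explains the formula for \<open>B\<close>. The exact law would be
  \<open>u(t) = F z(t + T)\<close>, under which \<open>z' = G z\<close>. The pseudo-predictor uses
  the value \<open>e^(G T) z(t)\<close> that \<open>z(t + T)\<close> would have if the law were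
  exact, and \<rho> measures the gap. The delicate point is the initial data. The closed loop starts
  from \<open>x 0\<close> and \<open>u\<close> on \<open>[-T, 0)\<close>, while \<rho> on
  \<open>[-T, 0)\<close> involves \<open>z\<close> on \<open>[0, T)\<close>. These values lie ahead
  of time 0 but are already fixed by the data through \<open>z' = A z + B u(t - T)\<close>.
  Asymptotic stability here is stability plus local attraction without a rate, so smallness is
  transported by linear estimates with constants uniform over all solutions, and convergence is
  transported separately. Jumps of \<open>u\<close> leave \<open>z\<close> differentiable only off a
  locally finite set, so differential equations are used in integrated form.\<close>

lemma bounded_bilinear_matrix_vector_mult:
  "bounded_bilinear ((*v) :: 'a::{euclidean_space, real_algebra_1} ^ 'n ^ 'm \<Rightarrow> 'a ^ 'n \<Rightarrow> 'a ^ 'm)"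
  unfolding bilinear_conv_bounded_bilinear[symmetric] bilinear_def
  by (auto intro!: linearI simp: vec_eq_iff matrix_vector_mult_def sum.distrib scaleR_sum_right
      distrib_left distrib_right)

lemma bounded_bilinear_matrix_matrix_mult:
  "bounded_bilinear ((**) :: real ^ 'k ^ 'm \<Rightarrow> real ^ 'n ^ 'k \<Rightarrow> real ^ 'n ^ 'm)"
  unfolding bilinear_conv_bounded_bilinear[symmetric] bilinear_def
  by (auto intro!: linearI simp: vec_eq_iff matrix_matrix_mult_def sum.distrib sum_distrib_left
      distrib_left distrib_right mult_ac)

lemmas matrix_vector_simps =
  bounded_bilinear.diff_left[OF bounded_bilinear_matrix_vector_mult]
  bounded_bilinear.add_left[OF bounded_bilinear_matrix_vector_mult]
  bounded_bilinear.minus_left[OF bounded_bilinear_matrix_vector_mult]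
  bounded_bilinear.minus_right[OF bounded_bilinear_matrix_vector_mult]
  bounded_bilinear.diff_right[OF bounded_bilinear_matrix_vector_mult]
  bounded_bilinear.add_right[OF bounded_bilinear_matrix_vector_mult]
  bounded_bilinear.sum_left[OF bounded_bilinear_matrix_vector_mult]
  bounded_bilinear.sum_right[OF bounded_bilinear_matrix_vector_mult]

lemmas continuous_on_matrix_vector_mult [continuous_intros] =
  bounded_bilinear.continuous_on[OF bounded_bilinear_matrix_vector_mult]

definition mpow :: "real ^ 'n ^ 'n \<Rightarrow> nat \<Rightarrow> real ^ 'n ^ 'n" where
  "mpow A k = ((\<lambda>M. A ** M) ^^ k) (mat 1)"

lemma mpow_0 [simp]: "mpow A 0 = mat 1"
  by (simp add: mpow_def)

lemma mpow_Suc: "mpow A (Suc k) = A ** mpow A k"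
  by (simp add: mpow_def)

lemma mpow_commute: "mpow A k ** A = A ** mpow A k"
  by (induction k) (simp_all add: mpow_Suc matrix_mul_assoc[symmetric])

lemma mpow_scaleR: "mpow (c *\<^sub>R A) k = c ^ k *\<^sub>R mpow A k"
  by (induction k)
    (simp_all add: mpow_Suc bounded_bilinear.scaleR_left[OF bounded_bilinear_matrix_matrix_mult]
      bounded_bilinear.scaleR_right[OF bounded_bilinear_matrix_matrix_mult])

text \<open>The norm in use is the Euclidean one on nested vectors. The product is estimated only
  through the constant of a bounded bilinear map, and the identity need not have norm 1; both
  defects are absorbed into \<open>K\<close> and the leading factor.\<close>

lemma norm_mpow_le: "\<exists>K\<ge>0. \<forall>k. norm (mpow A k) \<le> norm (mat 1 :: real ^ 'n ^ 'n) * K ^ k"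
  for A :: "real ^ 'n ^ 'n"
proof -
  obtain K where K: "K \<ge> 0" "\<And>(M :: real ^ 'n ^ 'n) (N :: real ^ 'n ^ 'n). norm (M ** N) \<le> norm M * norm N * K"
    using bounded_bilinear.nonneg_bounded[OF bounded_bilinear_matrix_matrix_mult] by blast
  have "norm (mpow A k) \<le> norm (mat 1 :: real ^ 'n ^ 'n) * (norm A * K) ^ k" for k
  proof (induction k)
    case (Suc k)
    have "norm (mpow A (Suc k)) \<le> norm A * norm (mpow A k) * K"
      using K(2)[of A "mpow A k"] by (simp add: mpow_Suc)
    also have "\<dots> = (norm A * K) * norm (mpow A k)"
      by simp
    also have "\<dots> \<le> (norm A * K) * (norm (mat 1 :: real ^ 'n ^ 'n) * (norm A * K) ^ k)"
      using Suc K(1) by (intro mult_left_mono) auto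
    finally show ?case by (simp add: mult_ac)
  qed simp
  then show ?thesis using K(1) by (intro exI[of _ "norm A * K"]) auto
qed

lemma summable_mexp_series: "summable (\<lambda>k. (t ^ k / fact k) *\<^sub>R mpow A k)"
  for A :: "real ^ 'n ^ 'n"
proof -
  obtain K where K: "K \<ge> 0" "\<And>k. norm (mpow A k) \<le> norm (mat 1 :: real ^ 'n ^ 'n) * K ^ k"
    using norm_mpow_le by blast
  have "summable (\<lambda>k. norm (mat 1 :: real ^ 'n ^ 'n) * (inverse (fact k) * (\<bar>t\<bar> * K) ^ k))"
    by (intro summable_mult summable_exp)
  then show ?thesis
  proof (rule summable_comparison_test')
    fix k :: nat
    have "norm ((t ^ k / fact k) *\<^sub>R mpow A k) = (\<bar>t\<bar> ^ k / fact k) * norm (mpow A k)"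
      by (simp add: power_abs)
    also have "\<dots> \<le> (\<bar>t\<bar> ^ k / fact k) * (norm (mat 1 :: real ^ 'n ^ 'n) * K ^ k)"
      by (intro mult_left_mono K) auto
    finally show "norm ((t ^ k / fact k) *\<^sub>R mpow A k)
        \<le> norm (mat 1 :: real ^ 'n ^ 'n) * (inverse (fact k) * (\<bar>t\<bar> * K) ^ k)"
      by (simp add: field_simps power_mult_distrib)
  qed
qed

lemma mexp_series: "mexp (t *\<^sub>R A) = (\<Sum>k. (t ^ k / fact k) *\<^sub>R mpow A k)"
  unfolding mexp_def mpow_def[symmetric] mpow_scaleR by simp

lemma mexp_0 [simp]: "mexp 0 = mat 1"
proof -
  have "mexp 0 = mexp (0 *\<^sub>R 0 :: real ^ 'a ^ 'a)" by simp
  also have "\<dots> = (\<Sum>k\<in>{0}. (0 ^ k / fact k) *\<^sub>R mpow 0 k)"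
    unfolding mexp_series by (rule suminf_finite) auto
  finally show ?thesis by simp
qed

text \<open>Multiplication by \<open>A\<close> from either side is bounded linear, so it passes
  through the series, and there \<open>A\<close> commutes with each of its powers.\<close>

lemma mexp_commute: "mexp (t *\<^sub>R A) ** A = A ** mexp (t *\<^sub>R A)"
proof -
  have "mexp (t *\<^sub>R A) ** A = (\<Sum>k. ((t ^ k / fact k) *\<^sub>R mpow A k) ** A)"
    unfolding mexp_series
    by (rule bounded_linear.suminf[OF bounded_bilinear.bounded_linear_left[OF bounded_bilinear_matrix_matrix_mult]
          summable_mexp_series])
  also have "\<dots> = (\<Sum>k. A ** ((t ^ k / fact k) *\<^sub>R mpow A k))"
    by (simp add: mpow_commute bounded_bilinear.scaleR_left[OF bounded_bilinear_matrix_matrix_mult]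
      bounded_bilinear.scaleR_right[OF bounded_bilinear_matrix_matrix_mult])
  also have "\<dots> = A ** mexp (t *\<^sub>R A)"
    unfolding mexp_series
    by (rule bounded_linear.suminf[OF bounded_bilinear.bounded_linear_right[OF bounded_bilinear_matrix_matrix_mult]
          summable_mexp_series, symmetric])
  finally show ?thesis .
qed

text \<open>A matrix is a vector of vectors, so two applications bring its derivative down to real
  entries.\<close>

lemma has_vector_derivative_vec:
  fixes f :: "real \<Rightarrow> 'a::real_normed_vector ^ 'n"
  assumes "\<And>i. ((\<lambda>t. f t $ i) has_vector_derivative f' $ i) (at x within S)"
  shows "(f has_vector_derivative f') (at x within S)"
  using assms unfolding has_vector_derivative_def has_derivative_within
  by (auto intro!: vec_tendstoI bounded_linear_scaleR_left)

text \<open>Each entry is a scalar power series in \<open>t\<close> that converges everywhere, hence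
  differentiable term by term. The shifted coefficients \<open>diffs c\<close> are those of the same
  entry of \<open>A ** mexp (t *\<^sub>R A)\<close>, because
  \<open>mpow A (Suc k) = A ** mpow A k\<close>.\<close>

lemma mexp_has_vector_derivative:
  "((\<lambda>t. mexp (t *\<^sub>R A)) has_vector_derivative A ** mexp (t *\<^sub>R A)) (at t within S)"
  for A :: "real ^ 'n ^ 'n"
proof (rule has_vector_derivative_vec, rule has_vector_derivative_vec)
  fix i j
  define c where "c k = mpow A k $ i $ j / fact k" for k
  have sum: "(\<lambda>k. c k * s ^ k) sums (mexp (s *\<^sub>R A) $ i $ j)" for s
  proof -
    have "bounded_linear (\<lambda>M :: real ^ 'n ^ 'n. M $ i $ j)"
      by (intro bounded_linear_vec_nth[THEN bounded_linear_compose] bounded_linear_vec_nth)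
    from bounded_linear.sums[OF this summable_sums[OF summable_mexp_series[of s A]]]
    show ?thesis by (simp add: c_def mexp_series mult.commute)
  qed
  have sum': "(\<lambda>k. diffs c k * s ^ k) sums ((A ** mexp (s *\<^sub>R A)) $ i $ j)" for s
  proof -
    have "bounded_linear (\<lambda>M :: real ^ 'n ^ 'n. (A ** M) $ i $ j)"
      by (intro bounded_linear_vec_nth[THEN bounded_linear_compose] bounded_linear_vec_nth
          bounded_bilinear.bounded_linear_right[OF bounded_bilinear_matrix_matrix_mult])
    from bounded_linear.sums[OF this summable_sums[OF summable_mexp_series[of s A]]]
    show ?thesis
      by (simp add: c_def mexp_series diffs_def mpow_Suc field_simps del: of_nat_Suc
          add: bounded_bilinear.scaleR_right[OF bounded_bilinear_matrix_matrix_mult])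
  qed
  have "((\<lambda>s. \<Sum>k. c k * s ^ k) has_field_derivative (\<Sum>k. diffs c k * t ^ k)) (at t)"
    by (rule termdiffs_strong_converges_everywhere) (rule sums_summable[OF sum])
  then have "((\<lambda>s. mexp (s *\<^sub>R A) $ i $ j) has_field_derivative (A ** mexp (t *\<^sub>R A)) $ i $ j) (at t)"
    by (simp add: sums_unique[OF sum, symmetric] sums_unique[OF sum', symmetric])
  then show "((\<lambda>s. mexp (s *\<^sub>R A) $ i $ j) has_vector_derivative (A ** mexp (t *\<^sub>R A)) $ i $ j) (at t within S)"
    unfolding has_real_derivative_iff_has_vector_derivative
    by (rule has_vector_derivative_at_within)
qed

lemma mexp_comp_has_vector_derivative:
  assumes "(f has_real_derivative c) (at t within S)"
  shows "((\<lambda>t. mexp (f t *\<^sub>R A)) has_vector_derivative c *\<^sub>R (A ** mexp (f t *\<^sub>R A))) (at t within S)"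
  using vector_diff_chain_within[OF assms[unfolded has_real_derivative_iff_has_vector_derivative]
      mexp_has_vector_derivative] by (simp add: o_def)

lemma continuous_on_mexp [continuous_intros]:
  assumes "continuous_on S f"
  shows "continuous_on S (\<lambda>t. mexp (f t *\<^sub>R A))"
proof -
  have "continuous_on UNIV (\<lambda>t. mexp (t *\<^sub>R A))"
    using mexp_has_vector_derivative has_vector_derivative_continuous
    by (blast intro: continuous_at_imp_continuous_on)
  from continuous_on_compose2[OF this assms] show ?thesis by simp
qed

text \<open>The product \<open>E (a + t) ** E (- t)\<close> has derivative zero, since
  \<open>A\<close> commutes with its exponential, so it keeps its value \<open>E a\<close> from
  \<open>t = 0\<close>. The case \<open>a = 0\<close> gives the inverse, and multiplying by
  \<open>E (- t) ** E t\<close> gives the addition law.\<close>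

lemma mexp_add: "mexp ((s + t) *\<^sub>R A) = mexp (s *\<^sub>R A) ** mexp (t *\<^sub>R A)"
  for A :: "real ^ 'n ^ 'n"
proof -
  note mm = bounded_bilinear_matrix_matrix_mult
  let ?E = "\<lambda>t. mexp (t *\<^sub>R A)"
  have E0: "?E (a + t) ** ?E (- t) = ?E a" for a t
  proof -
    have d: "((\<lambda>t. ?E (a + t) ** ?E (- t)) has_vector_derivative 0) (at t within UNIV)" for t
    proof -
      have 1: "((\<lambda>t. ?E (a + t)) has_vector_derivative 1 *\<^sub>R (A ** ?E (a + t))) (at t)"
        by (rule mexp_comp_has_vector_derivative) (auto intro!: derivative_eq_intros)
      have 2: "((\<lambda>t. ?E (- t)) has_vector_derivative (-1) *\<^sub>R (A ** ?E (- t))) (at t)"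
        by (rule mexp_comp_has_vector_derivative) (auto intro!: derivative_eq_intros)
      have "?E (a + t) ** ((-1) *\<^sub>R (A ** ?E (- t))) + (1 *\<^sub>R (A ** ?E (a + t))) ** ?E (- t) = 0"
        by (simp add: bounded_bilinear.minus_right[OF mm] matrix_mul_assoc mexp_commute)
      with bounded_bilinear.has_vector_derivative[OF mm 1 2] show ?thesis by simp
    qed
    from has_derivative_zero_constant[OF convex_UNIV, of "\<lambda>t. ?E (a + t) ** ?E (- t)"] d
    obtain c where c: "\<And>t. ?E (a + t) ** ?E (- t) = c"
      unfolding has_vector_derivative_def by auto
    from c[of 0] c[of t] show ?thesis by simp
  qed
  have inv: "?E (- t) ** ?E t = mat 1"
    using E0[of 0 "- t"] by simp
  have "?E (s + t) = ?E (s + t) ** (?E (- t) ** ?E t)"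
    unfolding inv by simp
  also have "\<dots> = ?E s ** ?E t"
    unfolding matrix_mul_assoc E0 ..
  finally show ?thesis .
qed

lemma mexp_add_vec: "mexp (s *\<^sub>R A) *v (mexp (t *\<^sub>R A) *v v) = mexp ((s + t) *\<^sub>R A) *v v"
  by (simp add: mexp_add matrix_vector_mul_assoc)

section \<open>Exponential decay for Hurwitz matrices\<close>

lemma norm_vector_scalar_mult: "norm (c *s v) = norm c * norm v" for v :: "complex ^ 'n"
  by (simp add: norm_vec_def norm_mult L2_set_right_distrib)

lemma bounded_bilinear_vector_scalar_mult:
  "bounded_bilinear ((*s) :: complex \<Rightarrow> complex ^ 'n \<Rightarrow> complex ^ 'n)"
  unfolding bilinear_conv_bounded_bilinear[symmetric] bilinear_def
  by (auto intro!: linearI simp: vec_eq_iff algebra_simps)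

text \<open>The vector \<open>p(C) v\<close>, evaluated by Horner's rule. Acting on a vector avoids
  forming powers of the matrix.\<close>

definition poly_mv :: "complex ^ 'n ^ 'n \<Rightarrow> complex poly \<Rightarrow> complex ^ 'n \<Rightarrow> complex ^ 'n" where
  "poly_mv C p v = fold_coeffs (\<lambda>a w. a *s v + C *v w) p 0"

lemma poly_mv_0 [simp]: "poly_mv C 0 v = 0"
  by (simp add: poly_mv_def)

lemma poly_mv_pCons [simp]: "poly_mv C (pCons a p) v = a *s v + C *v poly_mv C p v"
  by (cases "a = 0 \<and> p = 0") (auto simp: poly_mv_def)

lemma poly_mv_add: "poly_mv C (p + q) v = poly_mv C p v + poly_mv C q v"
  by (induction p q rule: poly_induct2)
    (simp_all add: matrix_vector_right_distrib vector_sadd_rdistrib)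

lemma poly_mv_smult: "poly_mv C (smult c p) v = c *s poly_mv C p v"
  by (induction p) (simp_all add: vector_add_ldistrib vector_smult_assoc vec.scale[symmetric])

lemma poly_mv_sum: "poly_mv C (\<Sum>i\<in>I. f i) v = (\<Sum>i\<in>I. poly_mv C (f i) v)"
  by (induction I rule: infinite_finite_induct) (simp_all add: poly_mv_add)

lemma poly_mv_vec_add: "poly_mv C p (v + w) = poly_mv C p v + poly_mv C p w"
  by (induction p) (simp_all add: vector_add_ldistrib matrix_vector_right_distrib)

lemma poly_mv_vec_scale: "poly_mv C p (c *s v) = c *s poly_mv C p v"
  by (induction p) (simp_all add: vector_add_ldistrib vector_smult_assoc vec.scale[symmetric] mult.commute)

lemma poly_mv_vec_mult: "poly_mv C p (C *v v) = C *v poly_mv C p v"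
  by (induction p) (simp_all add: matrix_vector_right_distrib vec.scale)

text \<open>The factor \<open>C - z\<close> is taken out on the left here and moved onto
  \<open>v\<close> in the primed version. The first form serves when \<open>C - z\<close> is
  injective, the second when \<open>z\<close> is an eigenvalue.\<close>

lemma poly_mv_linear_factor:
  "poly_mv C ([:- z, 1:] * q) v = C *v poly_mv C q v - z *s poly_mv C q v"
proof -
  have "[:- z, 1:] * q = pCons 0 q + smult (- z) q" by simp
  then show ?thesis by (simp only: poly_mv_add poly_mv_smult) simp
qed

lemma poly_mv_linear_factor':
  "poly_mv C ([:- z, 1:] * q) v = poly_mv C q (C *v v - z *s v)"
proof -
  have "C *v v - z *s v = C *v v + (- z) *s v" by simp
  then show ?thesis
    unfolding poly_mv_linear_factor by (simp only: poly_mv_vec_add poly_mv_vec_scale poly_mv_vec_mult) simp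
qed

text \<open>More than \<open>DIM(complex ^ 'n)\<close> iterates \<open>C\<^sup>i v\<close> are linearly dependent over the reals.\<close>

lemma ex_annihilating_poly: "\<exists>p. p \<noteq> 0 \<and> poly_mv C p v = 0" for v :: "complex ^ 'n"
proof -
  define X where "X i = poly_mv C (monom 1 i) v" for i
  define N where "N = DIM(complex ^ 'n)"
  show ?thesis
  \<comment> \<open>Linear dependence is a property of a set, which forgets repetitions. A repeated
    iterate therefore gets its own annihilating polynomial, the difference of two monomials.\<close>
  proof (cases "inj_on X {..N}")
    case False
    then obtain i j where ij: "i \<noteq> j" "X i = X j" by (auto simp: inj_on_def)
    have "monom 1 i + smult (-1) (monom 1 j) \<noteq> (0 :: complex poly)"
      using ij(1) by (simp add: monom_eq_iff')
    moreover have "poly_mv C (monom 1 i + smult (-1) (monom 1 j)) v = 0"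
      using ij(2) unfolding X_def poly_mv_add poly_mv_smult by simp
    ultimately show ?thesis by blast
  next
    case True
    then have "card (X ` {..N}) = Suc N" by (simp add: card_image)
    then have "dependent (X ` {..N})"
      using independent_bound[of "X ` {..N}"] by (auto simp: N_def)
    then obtain u w where w: "w \<in> X ` {..N}" "u w \<noteq> 0" and "(\<Sum>w\<in>X ` {..N}. u w *\<^sub>R w) = 0"
      using dependent_finite[of "X ` {..N}"] by auto
    then have sum0: "(\<Sum>i\<le>N. u (X i) *\<^sub>R X i) = 0"
      using True by (simp add: sum.reindex)
    define p :: "complex poly" where "p = (\<Sum>i\<le>N. smult (of_real (u (X i))) (monom 1 i))"
    from w obtain k where k: "k \<le> N" "u (X k) \<noteq> 0" by auto
    have "coeff p k = of_real (u (X k))"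
      using k(1) by (simp add: p_def coeff_sum if_distrib[of "(*) _"] cong: if_cong)
    with k(2) have "p \<noteq> 0" by auto
    moreover have "complex_of_real c *s w = c *\<^sub>R w" for c and w :: "complex ^ 'n"
      by (simp add: vec_eq_iff scaleR_conv_of_real[of r x for r and x :: complex])
    then have "poly_mv C p v = 0"
      using sum0 by (simp add: p_def poly_mv_sum poly_mv_smult X_def)
    ultimately show ?thesis by blast
  qed
qed

text \<open>The integrating factor \<open>e^(-z t)\<close> removes the term \<open>z y\<close>. What
  remains has a derivative bounded by an exponential, and the mean value inequality for
  vector-valued maps integrates this bound.\<close>

lemma exp_decay_scalar_ode:
  fixes y f :: "real \<Rightarrow> complex ^ 'n"
  assumes y: "\<And>t. (y has_vector_derivative (z *s y t + f t)) (at t)"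
    and z: "Re z < 0" and f: "\<beta> > 0" "\<And>t. t \<ge> 0 \<Longrightarrow> norm (f t) \<le> K * exp (- \<beta> * t)"
  shows "\<exists>K \<gamma>. \<gamma> > 0 \<and> (\<forall>t\<ge>0. norm (y t) \<le> K * exp (- \<gamma> * t))"
proof -
  define \<mu> where "\<mu> = - Re z"
  \<comment> \<open>Halving \<mu> keeps \<gamma> strictly below \<mu> even in the resonant case
    \<open>\<beta> = \<mu>\<close>, where a factor \<open>t\<close> would otherwise appear; the
    division by \<open>\<mu> - \<gamma>\<close> is then legitimate.\<close>
  define \<gamma> where "\<gamma> = min \<beta> (\<mu> / 2)"
  have \<gamma>: "\<gamma> > 0" "\<gamma> < \<mu>" "\<gamma> \<le> \<beta>" using f(1) z by (auto simp: \<gamma>_def \<mu>_def)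
  have K: "K \<ge> 0" using order_trans[OF norm_ge_zero f(2)[of 0]] by simp
  have f': "norm (f t) \<le> K * exp (- \<gamma> * t)" if "t \<ge> 0" for t
  proof -
    have "norm (f t) \<le> K * exp (- \<beta> * t)" by (rule f(2)[OF that])
    also have "\<dots> \<le> K * exp (- \<gamma> * t)"
      using K \<gamma>(3) that by (intro mult_left_mono) (auto intro: mult_right_mono)
    finally show ?thesis .
  qed
  define g where "g t = exp (t *\<^sub>R (- z)) *s y t" for t
  \<comment> \<open>An antiderivative of the bound on the derivative of \<open>g\<close>.\<close>
  define \<phi> where "\<phi> t = K / (\<mu> - \<gamma>) * exp ((\<mu> - \<gamma>) * t)" for t
  have g': "(g has_vector_derivative exp (t *\<^sub>R (- z)) *s f t) (at t)" for t
  proof -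
    have "exp (t *\<^sub>R (- z)) *s (z *s y t + f t) + (exp (t *\<^sub>R (- z)) * (- z)) *s y t
      = exp (t *\<^sub>R (- z)) *s f t"
      by (simp add: vec_eq_iff algebra_simps)
    with bounded_bilinear.has_vector_derivative[OF bounded_bilinear_vector_scalar_mult
        exp_scaleR_has_vector_derivative_right[of "- z" t UNIV] y[of t]]
    show ?thesis unfolding g_def by simp
  qed
  have \<phi>': "(\<phi> has_vector_derivative K * exp ((\<mu> - \<gamma>) * t)) (at t)" for t
    unfolding \<phi>_def has_real_derivative_iff_has_vector_derivative[symmetric]
    using \<gamma>(2) by (auto intro!: derivative_eq_intros)
  have norm_exp: "norm (exp (t *\<^sub>R (- z))) = exp (\<mu> * t)" for t
    by (simp add: norm_exp_eq_Re \<mu>_def mult.commute)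
  have "norm (g t - g 0) \<le> \<phi> t - \<phi> 0" if "t > 0" for t
  proof (rule differentiable_bound_general[OF that])
    show "continuous_on {0..t} g" "continuous_on {0..t} \<phi>"
      using g' \<phi>' has_vector_derivative_continuous
      by (blast intro: continuous_at_imp_continuous_on)+
    fix s assume "0 < s" "s < t"
    have "norm (exp (s *\<^sub>R (- z)) *s f s) = exp (\<mu> * s) * norm (f s)"
      by (simp only: norm_vector_scalar_mult norm_exp)
    also have "\<dots> \<le> exp (\<mu> * s) * (K * exp (- \<gamma> * s))"
      using \<open>0 < s\<close> by (intro mult_left_mono f') auto
    also have "\<dots> = K * exp ((\<mu> - \<gamma>) * s)"
      by (simp add: exp_add[symmetric] algebra_simps)
    finally show "norm (exp (s *\<^sub>R (- z)) *s f s) \<le> K * exp ((\<mu> - \<gamma>) * s)" .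
  qed (use g' \<phi>' in auto)
  then have g_le: "norm (g t) \<le> norm (y 0) + \<phi> t" if "t \<ge> 0" for t
  proof (cases "t = 0")
    case False
    with \<open>\<And>t. t > 0 \<Longrightarrow> norm (g t - g 0) \<le> \<phi> t - \<phi> 0\<close>[of t] that
    have "norm (g t - g 0) \<le> \<phi> t - \<phi> 0" by simp
    moreover have "\<phi> 0 \<ge> 0" using K \<gamma>(2) by (simp add: \<phi>_def)
    ultimately show ?thesis
      using norm_triangle_ineq2[of "g t" "g 0"] by (simp add: g_def)
  next
    case True
    then show ?thesis using K \<gamma>(2) by (simp add: g_def \<phi>_def)
  qed
  have "norm (y t) \<le> (norm (y 0) + K / (\<mu> - \<gamma>)) * exp (- \<gamma> * t)" if "t \<ge> 0" for t
  proof -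
    have "norm (y t) = exp (- \<mu> * t) * norm (g t)"
      unfolding g_def norm_vector_scalar_mult norm_exp by (simp add: exp_minus)
    also have "\<dots> \<le> exp (- \<mu> * t) * (norm (y 0) + \<phi> t)"
      using g_le[OF that] by (intro mult_left_mono) auto
    also have "\<dots> = norm (y 0) * exp (- \<mu> * t) + K / (\<mu> - \<gamma>) * exp (- \<gamma> * t)"
      by (simp add: \<phi>_def distrib_left exp_add[symmetric] algebra_simps)
    also have "norm (y 0) * exp (- \<mu> * t) \<le> norm (y 0) * exp (- \<gamma> * t)"
      using \<gamma>(2) that by (intro mult_left_mono) (auto intro: mult_right_mono)
    finally show ?thesis by (simp add: distrib_right)
  qed
  with \<gamma>(1) show ?thesis by blast
qed

lemma map_matrix_of_real_mult:
  "map_matrix complex_of_real (M ** N) = map_matrix complex_of_real M ** map_matrix complex_of_real N"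
  by (simp add: vec_eq_iff map_matrix_def matrix_matrix_mult_def)

lemma bounded_linear_map_matrix_of_real:
  "bounded_linear (map_matrix complex_of_real :: real ^ 'n ^ 'm \<Rightarrow> _)"
  unfolding linear_conv_bounded_linear[symmetric]
  by (rule linearI) (simp_all add: vec_eq_iff map_matrix_def scaleR_conv_of_real[of r x for r and x :: complex])

text \<open>Induction on the degree of a polynomial annihilating \<open>v\<close>, peeling off a linear factor with root
  \<open>z\<close>. If \<open>z\<close> is an eigenvalue, the orbit of \<open>v\<close> solves \<open>y' = z y + f\<close> where \<open>f\<close>, the orbit of
  \<open>(C - z) v\<close>, decays by the induction hypothesis; otherwise \<open>C - z\<close> is injective and the remaining
  factor already annihilates \<open>v\<close>.\<close>

lemma hurwitz_orbit_decay:
  fixes v :: "complex ^ 'n"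
  assumes "hurwitz M"
  shows "\<exists>K \<gamma>. \<gamma> > 0 \<and> (\<forall>t\<ge>0. norm (map_matrix complex_of_real (mexp (t *\<^sub>R M)) *v v) \<le> K * exp (- \<gamma> * t))"
proof -
  define C where "C = map_matrix complex_of_real M"
  define E where "E t = map_matrix complex_of_real (mexp (t *\<^sub>R M))" for t
  \<comment> \<open>The order \<open>E t ** C\<close> puts \<open>C\<close> next to the vector: the
    derivative of the orbit of \<open>v\<close> is the orbit of \<open>C *v v\<close>.\<close>
  have E': "(E has_vector_derivative E t ** C) (at t)" for t
    unfolding E_def C_def map_matrix_of_real_mult[symmetric] mexp_commute
    by (rule bounded_linear.has_vector_derivative[OF bounded_linear_map_matrix_of_real
          mexp_has_vector_derivative])
  have "\<exists>K \<gamma>. \<gamma> > 0 \<and> (\<forall>t\<ge>0. norm (E t *v v) \<le> K * exp (- \<gamma> * t))"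
    if "p \<noteq> 0" "poly_mv C p v = 0" for p v
    using that
  proof (induction "degree p" arbitrary: p v)
    case 0
    then obtain a where "p = [:a:]" "a \<noteq> 0" by (metis degree_eq_zeroE pCons_0_0)
    with 0 have "v = 0" by (simp add: vector_mul_eq_0)
    then show ?case by (intro exI[of _ 0] exI[of _ 1]) simp
  next
    case (Suc d)
    then have "\<not> constant (poly p)" by (simp add: constant_degree)
    then obtain z where "poly p z = 0" using fundamental_theorem_of_algebra by blast
    then obtain q where p: "p = [:- z, 1:] * q" by (auto simp: poly_eq_0_iff_dvd)
    with Suc.prems have q: "q \<noteq> 0" by auto
    with p Suc.hyps(2) have deg: "d = degree q"
      using degree_mult_eq[of "[:- z, 1:]" q] by (simp only: p) simp
    show ?case
    proof (cases "is_eigenvalue C z")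
      case True
      define w where "w = C *v v - z *s v"
      have "poly_mv C q w = 0"
        using Suc.prems(2) unfolding p poly_mv_linear_factor' w_def .
      from Suc.hyps(1)[OF deg q this] obtain K \<beta>
        where \<beta>: "\<beta> > 0" and K: "\<And>t. t \<ge> 0 \<Longrightarrow> norm (E t *v w) \<le> K * exp (- \<beta> * t)" by blast
      have "((\<lambda>t. E t *v v) has_vector_derivative (z *s (E t *v v) + E t *v w)) (at t)" for t
      proof -
        have "(E t ** C) *v v = E t *v (z *s v + w)"
          by (simp add: w_def matrix_vector_mul_assoc)
        also have "\<dots> = z *s (E t *v v) + E t *v w"
          by (simp add: matrix_vector_right_distrib vec.scale)
        finally show ?thesis
          using bounded_linear.has_vector_derivative[OF bounded_bilinear.bounded_linear_left[OF
                bounded_bilinear_matrix_vector_mult] E'[of t], of v] by simp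
      qed
      then show ?thesis
        using True assms \<beta> K unfolding hurwitz_def C_def[symmetric]
        by (intro exp_decay_scalar_ode) auto
    next
      case False
      have "C *v poly_mv C q v = z *s poly_mv C q v"
        using Suc.prems(2) unfolding p poly_mv_linear_factor by simp
      with False have "poly_mv C q v = 0" unfolding is_eigenvalue_def by blast
      from Suc.hyps(1)[OF deg q this] show ?thesis .
    qed
  qed
  with ex_annihilating_poly[of C v] show ?thesis unfolding E_def by blast
qed

text \<open>The orbit bound comes with a constant and a rate for each single vector. Applied to the
  standard basis, embedded isometrically into the complex space by \<open>c\<close>, it becomes
  uniform: the least rate and the sum of the constants work for every \<open>v\<close>. Since each
  \<open>K i\<close> is only known to be nonnegative, 1 is added to make the constant
  positive.\<close>

lemma hurwitz_imp_mexp_decay: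
  fixes M :: "real ^ 'n ^ 'n"
  assumes "hurwitz M"
  shows "\<exists>K>0. \<exists>\<gamma>>0. \<forall>t\<ge>0. \<forall>v. norm (mexp (t *\<^sub>R M) *v v) \<le> K * exp (- \<gamma> * t) * norm v"
proof -
  define c where "c v = (\<chi> i. complex_of_real (v $ i))" for v :: "real ^ 'n"
  have norm_c: "norm (c v) = norm v" for v
    by (simp add: c_def norm_vec_def)
  have c_mult: "map_matrix complex_of_real N *v c v = c (N *v v)" for N :: "real ^ 'n ^ 'n" and v
    by (simp add: vec_eq_iff c_def matrix_vector_mult_def map_matrix_def)
  have "\<forall>i. \<exists>K \<gamma>. \<gamma> > 0 \<and> (\<forall>t\<ge>0. norm (mexp (t *\<^sub>R M) *v axis i 1) \<le> K * exp (- \<gamma> * t))"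
    using hurwitz_orbit_decay[OF assms, of "c (axis _ 1)"] by (simp add: c_mult norm_c)
  then obtain K \<gamma> where \<gamma>: "\<And>i. \<gamma> i > 0"
    and K: "\<And>i t. t \<ge> 0 \<Longrightarrow> norm (mexp (t *\<^sub>R M) *v axis i 1) \<le> K i * exp (- \<gamma> i * t)"
    by metis
  define g where "g = Min (range \<gamma>)"
  have g: "g > 0" "\<And>i. g \<le> \<gamma> i" using \<gamma> by (auto simp: g_def)
  have K0: "K i \<ge> 0" for i using order_trans[OF norm_ge_zero K[of 0 i]] by simp
  have "norm (mexp (t *\<^sub>R M) *v v) \<le> (1 + (\<Sum>i\<in>UNIV. K i)) * exp (- g * t) * norm v" if "t \<ge> 0" for t v
  proof -
    have "mexp (t *\<^sub>R M) *v v = mexp (t *\<^sub>R M) *v (\<Sum>i\<in>UNIV. (v $ i) *s axis i 1)"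
      by (simp add: basis_expansion)
    also have "\<dots> = (\<Sum>i\<in>UNIV. (v $ i) *s (mexp (t *\<^sub>R M) *v axis i 1))"
      by (simp add: vec.sum vec.scale)
    also have "norm \<dots> \<le> (\<Sum>i\<in>UNIV. norm v * (K i * exp (- g * t)))"
    proof (rule sum_norm_le)
      fix i
      have "norm ((v $ i) *s (mexp (t *\<^sub>R M) *v axis i 1)) = \<bar>v $ i\<bar> * norm (mexp (t *\<^sub>R M) *v axis i 1)"
        by (simp add: scalar_mult_eq_scaleR)
      also have "\<dots> \<le> norm v * (K i * exp (- \<gamma> i * t))"
        using K[OF that, of i] component_le_norm_cart[of v i] by (intro mult_mono) auto
      also have "\<dots> \<le> norm v * (K i * exp (- g * t))"
        using g(2)[of i] that K0[of i] by (intro mult_left_mono) (auto intro: mult_right_mono)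
      finally show "norm ((v $ i) *s (mexp (t *\<^sub>R M) *v axis i 1)) \<le> norm v * (K i * exp (- g * t))" .
    qed
    also have "\<dots> = (\<Sum>i\<in>UNIV. K i) * exp (- g * t) * norm v"
      by (simp add: sum_distrib_left[symmetric] sum_distrib_right[symmetric])
    also have "\<dots> \<le> (1 + (\<Sum>i\<in>UNIV. K i)) * exp (- g * t) * norm v"
      by (intro mult_right_mono) auto
    finally show ?thesis .
  qed
  moreover have "1 + (\<Sum>i\<in>UNIV. K i) > 0" using sum_nonneg[of UNIV K] K0 by force
  ultimately show ?thesis using g(1) by blast
qed

section \<open>Piecewise continuous functions\<close>

lemma piecewise_continuous_on_mono:
  assumes "piecewise_continuous_on a b f" "b' \<le> b"
  shows "piecewise_continuous_on a b' f"
proof -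
  obtain D where "finite D" "continuous_on ({a..b} - D) f"
    using assms(1) by (auto simp: piecewise_continuous_on_def)
  moreover have "{a..b'} - D \<subseteq> {a..b} - D" using assms(2) by auto
  ultimately have "\<exists>D. finite D \<and> continuous_on ({a..b'} - D) f"
    using continuous_on_subset by blast
  then show ?thesis using assms unfolding piecewise_continuous_on_def by auto
qed

definition pw_cont :: "real \<Rightarrow> (real \<Rightarrow> 'a :: topological_space) \<Rightarrow> bool" where
  "pw_cont a f \<longleftrightarrow> (\<forall>b. piecewise_continuous_on a b f)"

text \<open>Piecewise continuity survives shrinking the right endpoint, so a lower bound on the
  endpoints considered makes no difference. This links \<open>pw_cont\<close> to the solution
  concepts, which quantify over \<open>b \<ge> 0\<close>.\<close>

lemma pw_cont_iff: "pw_cont a f \<longleftrightarrow> (\<forall>b\<ge>c. piecewise_continuous_on a b f)"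
  unfolding pw_cont_def by (meson max.cobounded1 max.cobounded2 piecewise_continuous_on_mono)

text \<open>Bisection reduces the claim to a neighbourhood of each point \<open>x\<close>. There the
  one-sided limits bound \<open>f\<close> on both sides, and the value \<open>f x\<close>, unrelated
  to these limits, enters the maximum separately.\<close>

lemma piecewise_continuous_on_bounded:
  fixes f :: "real \<Rightarrow> 'a::real_normed_vector"
  assumes f: "piecewise_continuous_on a b f"
  shows "bounded (f ` {a..b})"
proof (cases "a \<le> b")
  case True
  \<comment> \<open>The small intervals around a point in the bisection principle may leave the
    original interval, while the limits exist only inside it; \<open>J\<close> keeps that interval
    fixed during the induction.\<close>
  define J where "J = {a..b}"
  from True have "bounded (f ` ({a..b} \<inter> J))"
  proof (induction a b rule: Bolzano)
    case (trans c d e)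
    have "{c..e} \<inter> J \<subseteq> {c..d} \<inter> J \<union> {d..e} \<inter> J"
      by auto
    then have sub: "f ` ({c..e} \<inter> J) \<subseteq> f ` ({c..d} \<inter> J) \<union> f ` ({d..e} \<inter> J)"
      by blast
    from trans have "bounded (f ` ({c..d} \<inter> J) \<union> f ` ({d..e} \<inter> J))"
      unfolding bounded_Un by blast
    then show ?case using sub by (rule bounded_subset)
  next
    case (local x)
    then have local': "a \<le> x" "x \<le> b" by (auto simp: J_def)
    have "\<exists>d>0. \<exists>K. \<forall>s\<in>J. x - d < s \<and> s < x \<longrightarrow> norm (f s) \<le> K"
    proof (cases "a < x")
      case True
      then obtain l where "(f \<longlongrightarrow> l) (at_left x)"
        using f local' unfolding piecewise_continuous_on_def by blast
      then have "\<forall>\<^sub>F s in at_left x. dist (f s) l < 1" by (rule tendstoD) simp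
      then obtain c where c: "c < x" "\<And>s. c < s \<Longrightarrow> s < x \<Longrightarrow> dist (f s) l < 1"
        unfolding eventually_at_left_field by blast
      have "norm (f s) \<le> norm l + 1" if "c < s" "s < x" for s
        using c(2)[OF that] norm_triangle_ineq2[of "f s" l] by (simp add: dist_norm)
      with c(1) show ?thesis by (intro exI[of _ "x - c"]) auto
    qed (auto simp: J_def intro!: exI[of _ 1])
    then obtain d1 K1 where 1: "d1 > 0" "\<And>s. s \<in> J \<Longrightarrow> x - d1 < s \<Longrightarrow> s < x \<Longrightarrow> norm (f s) \<le> K1"
      by blast
    have "\<exists>d>0. \<exists>K. \<forall>s\<in>J. x < s \<and> s < x + d \<longrightarrow> norm (f s) \<le> K"
    proof (cases "x < b")
      case True
      then obtain l where "(f \<longlongrightarrow> l) (at_right x)"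
        using f local' unfolding piecewise_continuous_on_def by blast
      then have "\<forall>\<^sub>F s in at_right x. dist (f s) l < 1" by (rule tendstoD) simp
      then obtain c where c: "c > x" "\<And>s. x < s \<Longrightarrow> s < c \<Longrightarrow> dist (f s) l < 1"
        unfolding eventually_at_right_field by blast
      have "norm (f s) \<le> norm l + 1" if "x < s" "s < c" for s
        using c(2)[OF that] norm_triangle_ineq2[of "f s" l] by (simp add: dist_norm)
      with c(1) show ?thesis by (intro exI[of _ "c - x"]) auto
    qed (auto simp: J_def intro!: exI[of _ 1])
    then obtain d2 K2 where 2: "d2 > 0" "\<And>s. s \<in> J \<Longrightarrow> x < s \<Longrightarrow> s < x + d2 \<Longrightarrow> norm (f s) \<le> K2"
      by blast
    show ?case
    proof (intro exI[of _ "min d1 d2"] conjI allI impI)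
      fix c d assume cd: "c \<le> x \<and> x \<le> d \<and> d - c < min d1 d2"
      have "norm (f s) \<le> max (norm (f x)) (max K1 K2)" if "s \<in> {c..d} \<inter> J" for s
        using 1(2)[of s] 2(2)[of s] that cd by (cases s x rule: linorder_cases) auto
      then show "bounded (f ` ({c..d} \<inter> J))"
        by (intro boundedI[where B = "max (norm (f x)) (max K1 K2)"]) auto
    qed (use 1 2 in auto)
  qed
  then show ?thesis by (simp add: J_def)
qed auto

text \<open>Off the finite set \<open>D\<close> the function is continuous, hence measurable there,
  and it is bounded; the negligible set \<open>D\<close> does not affect integrability.\<close>

lemma piecewise_continuous_on_integrable:
  fixes f :: "real \<Rightarrow> 'a::euclidean_space"
  assumes "piecewise_continuous_on a b f"
  shows "f integrable_on {a..b}"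
proof -
  obtain D where D: "finite D" "continuous_on ({a..b} - D) f"
    using assms by (auto simp: piecewise_continuous_on_def)
  obtain K where K: "\<And>t. t \<in> {a..b} \<Longrightarrow> norm (f t) \<le> K"
    using piecewise_continuous_on_bounded[OF assms] unfolding bounded_iff by (metis imageI)
  have S: "{a..b} - D \<in> sets lebesgue"
    using D(1) by (intro sets.Diff) (auto intro: negligible_finite negligible_imp_sets)
  have spike: "g integrable_on ({a..b} - D) \<longleftrightarrow> g integrable_on {a..b}" for g :: "real \<Rightarrow> 'b::euclidean_space"
    by (rule integrable_spike_set_eq)
      (use D(1) in \<open>auto intro: negligible_subset[OF negligible_finite[OF D(1)]]\<close>)
  have "f integrable_on ({a..b} - D)"
  proof (rule measurable_bounded_by_integrable_imp_integrable)
    show "f \<in> borel_measurable (lebesgue_on ({a..b} - D))"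
      by (rule continuous_imp_measurable_on_sets_lebesgue[OF D(2) S])
    show "(\<lambda>_. K) integrable_on ({a..b} - D)"
      unfolding spike by (rule integrable_const_ivl)
  qed (use K S in auto)
  then show ?thesis unfolding spike .
qed

lemma piecewise_continuous_on_bilinear:
  assumes b: "bounded_bilinear pr"
    and f: "piecewise_continuous_on a b f" and g: "piecewise_continuous_on a b g"
  shows "piecewise_continuous_on a b (\<lambda>t. pr (f t) (g t))"
proof -
  obtain D1 where D1: "finite D1" "continuous_on ({a..b} - D1) f"
    using f by (auto simp: piecewise_continuous_on_def)
  obtain D2 where D2: "finite D2" "continuous_on ({a..b} - D2) g"
    using g by (auto simp: piecewise_continuous_on_def)
  have "continuous_on ({a..b} - (D1 \<union> D2)) (\<lambda>t. pr (f t) (g t))"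
    using D1(2) D2(2) by (intro bounded_bilinear.continuous_on[OF b]) (auto elim: continuous_on_subset)
  moreover have "finite (D1 \<union> D2)" using D1 D2 by simp
  ultimately have "\<exists>D. finite D \<and> continuous_on ({a..b} - D) (\<lambda>t. pr (f t) (g t))" by blast
  moreover have "\<exists>l. ((\<lambda>t. pr (f t) (g t)) \<longlongrightarrow> l) (at_left t)" if "a < t \<and> t \<le> b" for t
    using f g that bounded_bilinear.tendsto[OF b] unfolding piecewise_continuous_on_def by metis
  moreover have "\<exists>l. ((\<lambda>t. pr (f t) (g t)) \<longlongrightarrow> l) (at_right t)" if "a \<le> t \<and> t < b" for t
    using f g that bounded_bilinear.tendsto[OF b] unfolding piecewise_continuous_on_def by metis
  ultimately show ?thesis unfolding piecewise_continuous_on_def by blast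
qed

lemma piecewise_continuous_on_add:
  fixes f g :: "real \<Rightarrow> 'a::real_normed_vector"
  assumes f: "piecewise_continuous_on a b f" and g: "piecewise_continuous_on a b g"
  shows "piecewise_continuous_on a b (\<lambda>t. f t + g t)"
proof -
  obtain D1 where D1: "finite D1" "continuous_on ({a..b} - D1) f"
    using f by (auto simp: piecewise_continuous_on_def)
  obtain D2 where D2: "finite D2" "continuous_on ({a..b} - D2) g"
    using g by (auto simp: piecewise_continuous_on_def)
  have "continuous_on ({a..b} - (D1 \<union> D2)) (\<lambda>t. f t + g t)"
    using D1(2) D2(2) by (intro continuous_on_add) (auto elim: continuous_on_subset)
  moreover have "finite (D1 \<union> D2)" using D1 D2 by simp
  ultimately have "\<exists>D. finite D \<and> continuous_on ({a..b} - D) (\<lambda>t. f t + g t)" by blast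
  moreover have "\<exists>l. ((\<lambda>t. f t + g t) \<longlongrightarrow> l) (at_left t)" if "a < t \<and> t \<le> b" for t
    using f g that tendsto_add unfolding piecewise_continuous_on_def by metis
  moreover have "\<exists>l. ((\<lambda>t. f t + g t) \<longlongrightarrow> l) (at_right t)" if "a \<le> t \<and> t < b" for t
    using f g that tendsto_add unfolding piecewise_continuous_on_def by metis
  ultimately show ?thesis unfolding piecewise_continuous_on_def by blast
qed

lemma continuous_imp_piecewise_continuous_on:
  assumes f: "continuous_on {a..b} f"
  shows "piecewise_continuous_on a b f"
  unfolding piecewise_continuous_on_def
proof (intro conjI allI impI)
  show "\<exists>D. finite D \<and> continuous_on ({a..b} - D) f"
    using f by (intro exI[of _ "{}"]) auto
  show "\<exists>l. (f \<longlongrightarrow> l) (at_left t)" if "a < t \<and> t \<le> b" for t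
  proof -
    have "continuous_on {a..t} f" using that by (auto intro: continuous_on_subset[OF f])
    then have "(f \<longlongrightarrow> f t) (at t within {a..t})" using that by (auto simp: continuous_on_def)
    then show ?thesis using that by (auto simp: at_within_Icc_at_left)
  qed
  show "\<exists>l. (f \<longlongrightarrow> l) (at_right t)" if "a \<le> t \<and> t < b" for t
  proof -
    have "continuous_on {t..b} f" using that by (auto intro: continuous_on_subset[OF f])
    then have "(f \<longlongrightarrow> f t) (at t within {t..b})" using that by (auto simp: continuous_on_def)
    then show ?thesis using that by (auto simp: at_within_Icc_at_right)
  qed
qed

lemma continuous_imp_pw_cont: "continuous_on {a..} f \<Longrightarrow> pw_cont a f"
  unfolding pw_cont_def
  by (auto intro!: continuous_imp_piecewise_continuous_on elim: continuous_on_subset)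

lemma pw_cont_add: "pw_cont a f \<Longrightarrow> pw_cont a g \<Longrightarrow> pw_cont a (\<lambda>t. f t + g t)"
  for f g :: "real \<Rightarrow> 'a::real_normed_vector"
  unfolding pw_cont_def by (auto intro: piecewise_continuous_on_add)

lemma pw_cont_matrix_vector_mult:
  fixes f :: "real \<Rightarrow> real ^ 'n" and M :: "real \<Rightarrow> real ^ 'n ^ 'm"
  shows "continuous_on {a..} M \<Longrightarrow> pw_cont a f \<Longrightarrow> pw_cont a (\<lambda>t. M t *v f t)"
  using continuous_imp_pw_cont unfolding pw_cont_def
  by (blast intro: piecewise_continuous_on_bilinear[OF bounded_bilinear_matrix_vector_mult])

lemma pw_cont_integrable:
  fixes f :: "real \<Rightarrow> 'a::euclidean_space"
  assumes "pw_cont a f" "a \<le> c"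
  shows "f integrable_on {c..d}"
proof (cases "c \<le> d")
  case True
  have "f integrable_on {a..d}"
    using assms(1) piecewise_continuous_on_integrable by (auto simp: pw_cont_def)
  then show ?thesis
    by (rule integrable_on_subinterval) (use assms(2) in auto)
qed (auto simp: integrable_on_empty)

text \<open>The exceptional set for differentiating an antiderivative. Continuity is taken within
  \<open>{a..}\<close>, so the left endpoint counts only if \<open>f\<close> fails to be continuous
  from the right there.\<close>

definition disc_set :: "real \<Rightarrow> (real \<Rightarrow> 'a :: topological_space) \<Rightarrow> real set" where
  "disc_set a f = {t. t \<ge> a \<and> \<not> continuous (at t within {a..}) f}"

lemma finite_disc_set:
  assumes "pw_cont a f"
  shows "finite (disc_set a f \<inter> {..b})"
proof -
  \<comment> \<open>Continuity within \<open>{a..}\<close> at \<open>t = b\<close> also involves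
    values to the right of \<open>b\<close>, hence the margin 1.\<close>
  obtain D where D: "finite D" "continuous_on ({a..b + 1} - D) f"
    using assms unfolding piecewise_continuous_on_def pw_cont_def by metis
  have "continuous (at t within {a..}) f" if t: "a \<le> t" "t \<le> b" "t \<notin> D" for t
  proof -
    have "at t within ({a..b + 1} - D) = at t within {a..}"
    proof (rule at_within_nhd)
      show "open ({..<b + 1} - D)" using D(1) by (intro open_Diff finite_imp_closed) auto
    qed (use t in auto)
    moreover have "continuous (at t within ({a..b + 1} - D)) f"
      using D(2) t by (auto simp: continuous_on_eq_continuous_within)
    ultimately show ?thesis by simp
  qed
  then have "disc_set a f \<inter> {..b} \<subseteq> D" by (auto simp: disc_set_def)
  with D(1) show ?thesis by (rule finite_subset[rotated])
qed

lemma at_within_Icc_Ici: "at t within {a..t + 1} = at t within {a..}" if "a \<le> t" for a t :: real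
  by (rule at_within_nhd[of t "{..<t + 1}"]) (use that in auto)

lemma pw_cont_antiderivative:
  fixes f :: "real \<Rightarrow> 'a::euclidean_space"
  assumes f: "pw_cont a f" and t: "a \<le> t" "t \<notin> disc_set a f"
  shows "((\<lambda>t. integral {a..t} f) has_vector_derivative f t) (at t within {a..})"
proof -
  have "((\<lambda>t. integral {a..t} f) has_vector_derivative f t) (at t within ({a..t + 1} - {}))"
  proof (rule integral_has_vector_derivative_continuous_at)
    show "continuous (at t within ({a..t + 1} - {})) f"
      using t by (simp add: at_within_Icc_Ici disc_set_def)
  qed (use t pw_cont_integrable[OF f] in auto)
  then show ?thesis using t(1) by (simp add: at_within_Icc_Ici)
qed

lemma pw_cont_continuous_integral:
  fixes f :: "real \<Rightarrow> 'a::euclidean_space"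
  assumes f: "pw_cont a f"
  shows "continuous_on {a..} (\<lambda>t. integral {a..t} f)"
  unfolding continuous_on_eq_continuous_within
proof
  fix t assume t: "t \<in> {a..}"
  have "continuous_on {a..t + 1} (\<lambda>t. integral {a..t} f)"
    by (rule indefinite_integral_continuous_1) (use pw_cont_integrable[OF f] in auto)
  with t show "continuous (at t within {a..}) (\<lambda>t. integral {a..t} f)"
    by (auto simp: continuous_on_eq_continuous_within at_within_Icc_Ici[symmetric])
qed

lemma pw_cont_integral_diff:
  fixes f :: "real \<Rightarrow> 'a::euclidean_space"
  assumes "pw_cont a f" "a \<le> c" "c \<le> d"
  shows "integral {c..d} f = integral {a..d} f - integral {a..c} f"
  using Henstock_Kurzweil_Integration.integral_combine[of a c d f] assms pw_cont_integrable[of a f a]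
  by (auto simp: algebra_simps)

section \<open>Variation of constants\<close>

lemma tendsto_zero_at_top_iff:
  "(f \<longlongrightarrow> 0) at_top \<longleftrightarrow> (\<forall>e>0. \<exists>N. \<forall>t\<ge>N. norm (f t) < e)"
  for f :: "real \<Rightarrow> 'a::real_normed_vector"
  unfolding tendsto_iff eventually_at_top_linorder dist_norm by simp

lemma has_vector_derivative_shift_within:
  assumes "(f has_vector_derivative f') (at (t + c) within S)" "(\<lambda>t. t + c) ` S' \<subseteq> S"
  shows "((\<lambda>t. f (t + c)) has_vector_derivative f') (at t within S')"
proof -
  have "((\<lambda>t. t + c) has_vector_derivative 1) (at t within S')"
    by (auto intro!: derivative_eq_intros)
  from vector_diff_chain_within[OF this has_vector_derivative_within_subset[OF assms]]
  show ?thesis by (simp add: o_def)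
qed

lemma matrix_vector_mult_bound: "\<exists>K>0. \<forall>v. norm (M *v v) \<le> K * norm v"
  for M :: "real ^ 'n ^ 'm"
  using bounded_linear.pos_bounded[OF matrix_vector_mul_bounded_linear, of M]
  by (auto simp: mult.commute)

lemma mexp_compact_bound:
  "\<exists>K>0. \<forall>s\<in>{- r..r}. \<forall>v. norm (mexp (s *\<^sub>R M) *v v) \<le> K * norm v"
  for M :: "real ^ 'n ^ 'n"
proof -
  obtain L where L: "L > 0" "\<And>(N :: real ^ 'n ^ 'n) (v :: real ^ 'n). norm (N *v v) \<le> norm N * norm v * L"
    using bounded_bilinear.pos_bounded[OF bounded_bilinear_matrix_vector_mult] by blast
  have "bounded ((\<lambda>s. mexp (s *\<^sub>R M)) ` {- r..r})"
    by (intro compact_imp_bounded compact_continuous_image continuous_intros) auto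
  then obtain K where K: "K > 0" "\<And>s. s \<in> {- r..r} \<Longrightarrow> norm (mexp (s *\<^sub>R M)) \<le> K"
    unfolding bounded_pos by (metis imageI)
  have "norm (mexp (s *\<^sub>R M) *v v) \<le> (K * L) * norm v" if "s \<in> {- r..r}" for s v
  proof -
    have "norm (mexp (s *\<^sub>R M)) * norm v * L \<le> K * norm v * L"
      using K(2)[OF that] L(1) by (intro mult_right_mono) auto
    with L(2)[of "mexp (s *\<^sub>R M)" v] show ?thesis by (simp add: mult_ac)
  qed
  with K(1) L(1) show ?thesis by (intro exI[of _ "K * L"]) auto
qed

text \<open>Differentiating \<open>mexp ((b - s) *\<^sub>R M) *v z s\<close> in \<open>s\<close>
  cancels the term \<open>M *v z\<close> and leaves the forcing. The fundamental theorem is used in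
  the form that tolerates finitely many exceptional points for a continuous function.\<close>

lemma variation_of_constants:
  fixes z f :: "real \<Rightarrow> real ^ 'n"
  assumes "a \<le> b" "finite D" "continuous_on {a..b} z"
    and z': "\<And>t. t \<in> {a<..<b} - D \<Longrightarrow> (z has_vector_derivative (M *v z t + f t)) (at t)"
  shows "((\<lambda>s. mexp ((b - s) *\<^sub>R M) *v f s) has_integral (z b - mexp ((b - a) *\<^sub>R M) *v z a)) {a..b}"
proof -
  have "((\<lambda>s. mexp ((b - s) *\<^sub>R M) *v z s) has_vector_derivative mexp ((b - t) *\<^sub>R M) *v f t) (at t)"
    if "t \<in> {a<..<b} - D" for t
  proof -
    have "((\<lambda>s. mexp ((b - s) *\<^sub>R M)) has_vector_derivative (-1) *\<^sub>R (M ** mexp ((b - t) *\<^sub>R M))) (at t)"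
      by (rule mexp_comp_has_vector_derivative) (auto intro!: derivative_eq_intros)
    from bounded_bilinear.has_vector_derivative[OF bounded_bilinear_matrix_vector_mult this z'[OF that]]
    show ?thesis
      by (simp add: matrix_vector_simps mexp_commute[symmetric] matrix_vector_mul_assoc)
  qed
  from fundamental_theorem_of_calculus_interior_strong[OF assms(2,1) this]
  show ?thesis using assms(3) by (simp add: continuous_intros)
qed

lemma has_integral_exp_decay:
  fixes \<gamma> :: real
  assumes "a \<le> b" "\<gamma> > 0"
  shows "((\<lambda>s. exp (- \<gamma> * (b - s))) has_integral (1 - exp (- \<gamma> * (b - a))) / \<gamma>) {a..b}"
proof -
  have "((\<lambda>s. exp (- \<gamma> * (b - s)) / \<gamma>) has_vector_derivative exp (- \<gamma> * (b - t))) (at t within {a..b})" for t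
    unfolding has_real_derivative_iff_has_vector_derivative[symmetric]
    using assms(2) by (auto intro!: derivative_eq_intros)
  from fundamental_theorem_of_calculus[OF assms(1) this]
  show ?thesis by (simp add: diff_divide_distrib)
qed

text \<open>The version for solutions on a half-line, where the exceptional set is only locally
  finite and derivatives are taken within \<open>{c..}\<close>. At interior points these are
  two-sided.\<close>

lemma variation_of_constants_Ici:
  fixes z f :: "real \<Rightarrow> real ^ 'n"
  assumes z: "continuous_on {c..} z" and D: "\<And>b. finite (D \<inter> {c..b})"
    and z': "\<And>t. t \<in> {c..} - D \<Longrightarrow> (z has_vector_derivative (M *v z t + f t)) (at t within {c..})"
    and "c \<le> a" "a \<le> b"
  shows "((\<lambda>s. mexp ((b - s) *\<^sub>R M) *v f s) has_integral (z b - mexp ((b - a) *\<^sub>R M) *v z a)) {a..b}"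
proof (rule variation_of_constants[OF \<open>a \<le> b\<close> D])
  show "continuous_on {a..b} z"
    by (rule continuous_on_subset[OF z]) (use \<open>c \<le> a\<close> in auto)
  fix t assume t: "t \<in> {a<..<b} - D \<inter> {c..b}"
  then have "(z has_vector_derivative (M *v z t + f t)) (at t within {c..})"
    using \<open>c \<le> a\<close> by (intro z') auto
  moreover have "at t within {c..} = at t"
    using t \<open>c \<le> a\<close> by (intro at_within_interior) auto
  ultimately show "(z has_vector_derivative (M *v z t + f t)) (at t)" by simp
qed

section \<open>The closed loop and its residual\<close>

text \<open>The bounds on \<open>h i\<close> place each window \<open>[t - T, t - h i]\<close> in
  the past and keep every delayed input inside the recorded history of length
  \<open>T\<close>.\<close>

locale input_delay_system =
  fixes A :: "real ^ 'n ^ 'n" and Bi :: "nat \<Rightarrow> real ^ 'm ^ 'n" and B :: "real ^ 'm ^ 'n"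
    and F :: "real ^ 'n ^ 'm" and h :: "nat \<Rightarrow> real" and T :: real
  assumes h_nonneg: "i \<in> {1..3} \<Longrightarrow> 0 \<le> h i" and h_le: "i \<in> {1..3} \<Longrightarrow> h i \<le> T"
    and B_eq: "B = (\<Sum>i = 1..3. mexp (- h i *\<^sub>R A) ** Bi i)"
    and hurwitz_closed: "hurwitz (A + B ** F)"
begin

abbreviation "E t \<equiv> mexp (t *\<^sub>R A)"
abbreviation "G t \<equiv> mexp (t *\<^sub>R (A + B ** F))"
abbreviation "\<Phi> \<equiv> predictor_term A Bi h T"
abbreviation "cl \<equiv> closed_loop_solution A Bi h T B F"
abbreviation "ids \<equiv> integral_delay_solution A T B F"

lemma T_nonneg: "0 \<le> T"
  using h_nonneg[of 1] h_le[of 1] by simp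

section \<open>The predictor term: product form, derivative and size\<close>

definition antid :: "(real \<Rightarrow> real ^ 'm) \<Rightarrow> nat \<Rightarrow> real \<Rightarrow> real ^ 'n" where
  "antid u i t = integral {- T..t} (\<lambda>s. E (- s) *v (Bi i *v u s))"

text \<open>The matrix \<open>M\<close> is left open because the weights of both \<open>A\<close>
  and \<open>A + B ** F\<close> occur.\<close>

lemma pw_cont_weighted:
  fixes C :: "real ^ 'm ^ 'n"
  assumes "pw_cont a u"
  shows "pw_cont a (\<lambda>s. mexp (- s *\<^sub>R M) *v (C *v u s))"
  by (intro pw_cont_matrix_vector_mult continuous_intros assms)

lemma disc_set_weighted:
  fixes C :: "real ^ 'm ^ 'n"
  shows "disc_set a (\<lambda>s. mexp (- s *\<^sub>R M) *v (C *v u s)) \<subseteq> disc_set a u"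
proof -
  have "continuous (at t within {a..}) (\<lambda>s. mexp (- s *\<^sub>R M) *v (C *v u s))"
    if "t \<ge> a" "continuous (at t within {a..}) u" for t
  proof -
    have "continuous_on {a..} (\<lambda>s. mexp (- s *\<^sub>R M))" by (intro continuous_intros)
    with that(1) have "continuous (at t within {a..}) (\<lambda>s. mexp (- s *\<^sub>R M))"
      by (auto simp: continuous_on_eq_continuous_within)
    with that(2) show ?thesis
      by (intro bounded_bilinear.continuous[OF bounded_bilinear_matrix_vector_mult] continuous_const)
  qed
  then show ?thesis by (auto simp: disc_set_def)
qed

text \<open>The kernel splits as \<open>E (t - h i) ** E (- s)\<close>, and the factor depending on
  \<open>t\<close> leaves the integral. A moving window with a \<open>t\<close>-dependent kernel
  becomes a smooth factor times a difference of antiderivatives, which can be differentiated by the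
  product rule and the fundamental theorem.\<close>

lemma predictor_term_eq:
  assumes "pw_cont (- T) u" "t \<ge> 0"
  shows "\<Phi> u t = (\<Sum>i = 1..3. E (t - h i) *v (antid u i (t - h i) - antid u i (t - T)))"
  unfolding predictor_term_def
proof (rule sum.cong)
  fix i :: nat assume i: "i \<in> {1..3}"
  let ?w = "\<lambda>s. E (- s) *v (Bi i *v u s)"
  have w: "?w integrable_on {t - T..t - h i}"
    using pw_cont_integrable[OF pw_cont_weighted[OF assms(1)]] assms(2) by auto
  have "integral {t - T..t - h i} (\<lambda>s. E (t - s - h i) *v (Bi i *v u s))
      = integral {t - T..t - h i} (\<lambda>s. E (t - h i) *v ?w s)"
  proof (rule integral_cong)
    fix s
    show "E (t - s - h i) *v (Bi i *v u s) = E (t - h i) *v ?w s"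
      unfolding mexp_add_vec by (rule arg_cong[where f = "\<lambda>c. E c *v _"]) simp
  qed
  also have "\<dots> = E (t - h i) *v integral {t - T..t - h i} ?w"
    using integral_linear[OF w matrix_vector_mul_bounded_linear[of "E (t - h i)"]] by (simp add: o_def)
  also have "integral {t - T..t - h i} ?w = antid u i (t - h i) - antid u i (t - T)"
    unfolding antid_def using assms(2) h_le[OF i]
    by (intro pw_cont_integral_diff pw_cont_weighted assms(1)) auto
  finally show "integral {t - T..t - h i} (\<lambda>s. E (t - s - h i) *v (Bi i *v u s))
    = E (t - h i) *v (antid u i (t - h i) - antid u i (t - T))" .
qed simp

lemma predictor_term_continuous:
  assumes "pw_cont (- T) u"
  shows "continuous_on {0..} (\<Phi> u)"
proof -
  have c: "continuous_on {- T..} (antid u i)" for i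
    unfolding antid_def by (intro pw_cont_continuous_integral pw_cont_weighted assms)
  have "continuous_on {0..} (\<lambda>t. \<Sum>i = 1..3. E (t - h i) *v (antid u i (t - h i) - antid u i (t - T)))"
    using h_nonneg h_le
    by (intro continuous_intros continuous_on_compose2[OF c]) force+
  then show ?thesis
    by (rule continuous_on_cong[THEN iffD1, rotated -1]) (auto simp: predictor_term_eq[OF assms])
qed

text \<open>The defining formula of \<open>B\<close> enters here: \<open>e^(-A (h i))\<close>
  transports each input matrix to the common delay.\<close>

lemma sum_input_matrices: "(\<Sum>i = 1..3. E (T - h i) *v (Bi i *v w)) = E T *v (B *v w)"
  by (simp add: B_eq matrix_vector_simps matrix_vector_mul_assoc[symmetric] mexp_add_vec
      del: scaleR_minus_left)

text \<open>In each summand the outer exponential contributes \<open>A\<close> times the summand,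
  the upper limit contributes the delayed input \<open>Bi i *v u (t - h i)\<close>, and the lower
  limit contributes \<open>u (t - T)\<close> with a matrix that sums to
  \<open>E T ** B\<close>.\<close>

lemma predictor_term_derivative:
  assumes u: "pw_cont (- T) u"
  shows "\<exists>D. (\<forall>b. finite (D \<inter> {0..b})) \<and> (\<forall>t\<in>{0..} - D.
    (\<Phi> u has_vector_derivative
      (A *v \<Phi> u t + (\<Sum>i = 1..3. Bi i *v u (t - h i)) - E T *v (B *v u (t - T)))) (at t within {0..}))"
proof -
  let ?S = "disc_set (- T) u"
  \<comment> \<open>A discontinuity of \<open>u\<close> is felt whenever an endpoint of one of the
    windows passes it, so the exceptional set consists of its shifts by \<open>T\<close> and by each
    \<open>h i\<close>.\<close>
  define D where "D = (\<Union>c\<in>insert T (h ` {1..3}). (\<lambda>s. s + c) ` ?S)"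
  have "finite (D \<inter> {0..b})" for b
  proof -
    have "D \<inter> {0..b} \<subseteq> (\<Union>c\<in>insert T (h ` {1..3}). (\<lambda>s. s + c) ` (?S \<inter> {..b}))"
      using h_nonneg T_nonneg by (fastforce simp: D_def)
    then show ?thesis
      by (rule finite_subset) (auto intro: finite_disc_set[OF u])
  qed
  moreover have "(\<Phi> u has_vector_derivative
      (A *v \<Phi> u t + (\<Sum>i = 1..3. Bi i *v u (t - h i)) - E T *v (B *v u (t - T)))) (at t within {0..})"
    if t: "t \<in> {0..} - D" for t
  proof -
    \<comment> \<open>The sum \<open>t + - c\<close> matches the form of the shift in
      \<open>has_vector_derivative_shift_within\<close>.\<close>
    have nd: "t + - c \<notin> ?S" if "c \<in> insert T (h ` {1..3})" for c
    proof
      assume "t + - c \<in> ?S"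
      then have "t \<in> (\<lambda>s. s + c) ` ?S" by (intro image_eqI[of _ _ "t + - c"]) auto
      with that t show False unfolding D_def by blast
    qed
    have a': "((\<lambda>t. antid u i (t + - c)) has_vector_derivative E (- (t + - c)) *v (Bi i *v u (t + - c))) (at t within {0..})"
      if c: "c \<in> insert T (h ` {1..3})" for i c
    proof -
      have c': "c \<le> T" using c h_le by auto
      show ?thesis
        unfolding antid_def
      proof (rule has_vector_derivative_shift_within, rule pw_cont_antiderivative[OF pw_cont_weighted[OF u]])
        show "t + - c \<notin> disc_set (- T) (\<lambda>s. E (- s) *v (Bi i *v u s))"
          using nd[OF c] disc_set_weighted by blast
      qed (use t c' in auto)
    qed
    let ?J = "\<lambda>i t. antid u i (t - h i) - antid u i (t - T)"
    have "((\<lambda>t. E (t - h i) *v ?J i t) has_vector_derivative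
        (A *v (E (t - h i) *v ?J i t) + Bi i *v u (t - h i) - E (T - h i) *v (Bi i *v u (t - T)))) (at t within {0..})"
      if i: "i \<in> {1..3}" for i
    proof -
      have 1: "((\<lambda>t. E (t - h i)) has_vector_derivative 1 *\<^sub>R (A ** E (t - h i))) (at t within {0..})"
        by (rule mexp_comp_has_vector_derivative) (auto intro!: derivative_eq_intros)
      have "((\<lambda>t. antid u i (t + - h i) - antid u i (t + - T)) has_vector_derivative
          (E (- (t + - h i)) *v (Bi i *v u (t + - h i)) - E (- (t + - T)) *v (Bi i *v u (t + - T)))) (at t within {0..})"
        by (intro has_vector_derivative_diff a') (use i in auto)
      from bounded_bilinear.has_vector_derivative[OF bounded_bilinear_matrix_vector_mult 1 this]
      have "((\<lambda>t. E (t - h i) *v ?J i t) has_vector_derivative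
         (E (t - h i) *v (E (h i - t) *v (Bi i *v u (t - h i)) - E (T - t) *v (Bi i *v u (t - T)))
          + (A ** E (t - h i)) *v ?J i t)) (at t within {0..})"
        by simp
      moreover have "E (t - h i) *v (E (h i - t) *v (Bi i *v u (t - h i)) - E (T - t) *v (Bi i *v u (t - T)))
          + (A ** E (t - h i)) *v ?J i t
        = A *v (E (t - h i) *v ?J i t) + Bi i *v u (t - h i) - E (T - h i) *v (Bi i *v u (t - T))"
        unfolding bounded_bilinear.diff_right[OF bounded_bilinear_matrix_vector_mult, of "E (t - h i)" "E _ *v _"]
          mexp_add_vec matrix_vector_mul_assoc[symmetric] by simp
      ultimately show ?thesis by simp
    qed
    then have "((\<lambda>t. \<Sum>i = 1..3. E (t - h i) *v ?J i t) has_vector_derivative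
        (\<Sum>i = 1..3. A *v (E (t - h i) *v ?J i t) + Bi i *v u (t - h i) - E (T - h i) *v (Bi i *v u (t - T)))) (at t within {0..})"
      by (rule has_vector_derivative_sum)
    moreover have "(\<Sum>i = 1..3. A *v (E (t - h i) *v ?J i t) + Bi i *v u (t - h i) - E (T - h i) *v (Bi i *v u (t - T)))
      = A *v \<Phi> u t + (\<Sum>i = 1..3. Bi i *v u (t - h i)) - E T *v (B *v u (t - T))"
      using t unfolding sum_subtractf sum.distrib sum_input_matrices
      by (simp add: predictor_term_eq[OF u] matrix_vector_simps)
    ultimately show ?thesis
      using t by (intro has_vector_derivative_transform[OF _ predictor_term_eq[OF u]]) auto
  qed
  ultimately show ?thesis by blast
qed

text \<open>The half-open window matters at \<open>t = 0\<close>, where it is exactly the initial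
  history and \<open>u 0\<close> is not part of the data. If \<open>h i = 0\<close>, the integration
  interval does contain \<open>t\<close>, but a single point does not affect the integral.\<close>

lemma predictor_term_bound:
  obtains K where "K > 0" "\<And>u t m. pw_cont (- T) u \<Longrightarrow> t \<ge> 0 \<Longrightarrow> m \<ge> 0 \<Longrightarrow>
      (\<And>s. s \<in> {t - T..<t} \<Longrightarrow> norm (u s) \<le> m) \<Longrightarrow> norm (\<Phi> u t) \<le> K * m"
proof -
  obtain K where K: "K > 0" "\<And>s v. s \<in> {- T..T} \<Longrightarrow> norm (E s *v v) \<le> K * norm v"
    using mexp_compact_bound[of T A] by blast
  have "\<forall>i. \<exists>L>0. \<forall>v. norm (Bi i *v v) \<le> L * norm v" using matrix_vector_mult_bound by blast
  then obtain L where L: "\<And>i. L i > 0" "\<And>i v. norm (Bi i *v v) \<le> L i * norm v" by metis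
  have bound: "norm (\<Phi> u t) \<le> (1 + (\<Sum>i = 1..3. K * L i * (T - h i))) * m"
    if u: "pw_cont (- T) u" and t: "t \<ge> 0" and m: "m \<ge> 0" "\<And>s. s \<in> {t - T..<t} \<Longrightarrow> norm (u s) \<le> m" for u t m
  proof -
    have "norm (\<Phi> u t) \<le> (\<Sum>i = 1..3. K * L i * (T - h i) * m)"
      unfolding predictor_term_def
    proof (rule sum_norm_le)
      fix i :: nat assume i: "i \<in> {1..3}"
      let ?f = "\<lambda>s. E (t - s - h i) *v (Bi i *v u s)"
      have "pw_cont (- T) ?f"
        by (intro pw_cont_matrix_vector_mult continuous_intros u)
      then have "?f integrable_on {t - T..t - h i}"
        by (rule pw_cont_integrable) (use t in auto)
      then have "(?f has_integral integral {t - T..t - h i} ?f) (cbox (t - T) (t - h i))"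
        by (simp add: integrable_integral)
      then have "norm (integral {t - T..t - h i} ?f) \<le> K * (L i * m) * measure lborel (cbox (t - T) (t - h i))"
      proof (rule has_integral_bound_spike_finite[rotated 2])
        fix s assume s: "s \<in> cbox (t - T) (t - h i) - {t}"
        then have "norm (?f s) \<le> K * norm (Bi i *v u s)"
          using h_nonneg[OF i] T_nonneg by (intro K) auto
        also have "norm (Bi i *v u s) \<le> L i * norm (u s)" by (rule L)
        also have "norm (u s) \<le> m" using s h_nonneg[OF i] by (intro m) auto
        finally show "norm (?f s) \<le> K * (L i * m)" using K(1) L(1)[of i] by simp
      qed (use K(1) L(1)[of i] m(1) in auto)
      then show "norm (integral {t - T..t - h i} ?f) \<le> K * L i * (T - h i) * m"
        using h_le[OF i] by (simp add: mult_ac)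
    qed
    also have "\<dots> \<le> (1 + (\<Sum>i = 1..3. K * L i * (T - h i))) * m"
      using m(1) by (simp add: sum_distrib_right[symmetric] distrib_right)
    finally show ?thesis .
  qed
  have "0 \<le> (\<Sum>i = 1..3. K * L i * (T - h i))"
    using K(1) L(1) h_le by (intro sum_nonneg mult_nonneg_nonneg) (auto simp: less_imp_le)
  then have "1 + (\<Sum>i = 1..3. K * L i * (T - h i)) > 0" by simp
  from that[OF this bound] show thesis .
qed

text \<open>\<open>zeta x u t\<close> is \<open>z (t + T)\<close>: the shift makes the forcing term \<open>B u(t)\<close> undelayed and lets
  \<open>zeta\<close> and the residual live on the same interval \<open>[-T, \<infinity>)\<close> as \<open>u\<close>.\<close>

definition zeta :: "(real \<Rightarrow> real ^ 'n) \<Rightarrow> (real \<Rightarrow> real ^ 'm) \<Rightarrow> real \<Rightarrow> real ^ 'n" where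
  "zeta x u t = E (- T) *v (x (t + T) - \<Phi> u (t + T))"

definition residual :: "(real \<Rightarrow> real ^ 'n) \<Rightarrow> (real \<Rightarrow> real ^ 'm) \<Rightarrow> real \<Rightarrow> real ^ 'm" where
  "residual x u t = u t - F *v zeta x u t"

section \<open>Differential and integral equations of closed-loop solutions\<close>

lemma closed_loop_solution_pw_cont: "cl x u \<Longrightarrow> pw_cont (- T) u"
  unfolding closed_loop_solution_def pw_cont_iff[of _ _ 0] by (elim conjE)

lemma E_cancel: "E T *v (E (- T) *v v) = v" "E (- T) *v (E T *v v) = v"
  unfolding mexp_add_vec by simp_all

lemma closed_loop_solution_x:
  "x t = E T *v zeta x u (t - T) + \<Phi> u t"
  by (simp only: zeta_def E_cancel diff_add_cancel)

lemma closed_loop_solution_u: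
  assumes "cl x u" "t \<ge> 0"
  shows "u t = F *v (G T *v zeta x u (t - T))"
proof -
  have "u t = (F ** G T ** E (- T)) *v (x t - \<Phi> u t)"
    by (rule assms(1)[unfolded closed_loop_solution_def, THEN conjunct2, THEN conjunct2, THEN conjunct2,
          rule_format, OF assms(2)])
  then show ?thesis by (simp only: zeta_def diff_add_cancel matrix_vector_mul_assoc matrix_mul_assoc)
qed

lemma zeta_continuous:
  assumes "cl x u"
  shows "continuous_on {- T..} (zeta x u)"
proof -
  have "continuous_on {0..} (\<lambda>t. x t - \<Phi> u t)"
    using assms[unfolded closed_loop_solution_def, THEN conjunct1]
    by (intro continuous_on_diff predictor_term_continuous closed_loop_solution_pw_cont[OF assms])
  then have "continuous_on {- T..} (\<lambda>t. x (t + T) - \<Phi> u (t + T))"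
    by (rule continuous_on_compose2) (auto intro!: continuous_intros)
  then show ?thesis unfolding zeta_def[abs_def] by (intro continuous_on_matrix_vector_mult continuous_on_const)
qed

text \<open>In the derivative of \<open>x - \<Phi> u\<close> all inputs delayed by
  \<open>h i\<close> cancel; what is left, \<open>E T *v (B *v u (t - T))\<close>, loses its
  exponential to the prefactor \<open>E (- T)\<close> and its delay to the shift by
  \<open>T\<close>.\<close>

lemma zeta_derivative:
  assumes cl: "cl x u"
  shows "\<exists>D. (\<forall>b. finite (D \<inter> {- T..b})) \<and> (\<forall>t\<in>{- T..} - D.
    (zeta x u has_vector_derivative (A *v zeta x u t + B *v u t)) (at t within {- T..}))"
proof -
  let ?x' = "\<lambda>t. A *v x t + (\<Sum>i = 1..3. Bi i *v u (t - h i))"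
  let ?\<Phi>' = "\<lambda>t. A *v \<Phi> u t + (\<Sum>i = 1..3. Bi i *v u (t - h i)) - E T *v (B *v u (t - T))"
  obtain D1 where D1: "\<And>b. finite (D1 \<inter> {0..b})"
    and x': "\<And>t. t \<in> {0..} - D1 \<Longrightarrow> (x has_vector_derivative ?x' t) (at t within {0..})"
    using cl[unfolded closed_loop_solution_def, THEN conjunct2, THEN conjunct2, THEN conjunct1] by blast
  obtain D2 where D2: "\<And>b. finite (D2 \<inter> {0..b})"
    and \<Phi>': "\<And>t. t \<in> {0..} - D2 \<Longrightarrow> (\<Phi> u has_vector_derivative ?\<Phi>' t) (at t within {0..})"
    using predictor_term_derivative[OF closed_loop_solution_pw_cont[OF cl]] by blast
  define D where "D = (\<lambda>s. s - T) ` (D1 \<union> D2)"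
  have "finite (D \<inter> {- T..b})" for b
  proof -
    have "D \<inter> {- T..b} \<subseteq> (\<lambda>s. s - T) ` (D1 \<inter> {0..b + T} \<union> D2 \<inter> {0..b + T})"
      by (auto simp: D_def)
    then show ?thesis by (rule finite_subset) (use D1 D2 in auto)
  qed
  moreover have "(zeta x u has_vector_derivative (A *v zeta x u t + B *v u t)) (at t within {- T..})"
    if t: "t \<in> {- T..} - D" for t
  proof -
    have "t + T \<notin> D1 \<union> D2"
    proof
      assume "t + T \<in> D1 \<union> D2"
      then have "t \<in> D" unfolding D_def by (intro image_eqI[of _ _ "t + T"]) auto
      with t show False by simp
    qed
    with t have "((\<lambda>s. x s - \<Phi> u s) has_vector_derivative ?x' (t + T) - ?\<Phi>' (t + T)) (at (t + T) within {0..})"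
      by (intro has_vector_derivative_diff x' \<Phi>') auto
    then have "((\<lambda>s. x (s + T) - \<Phi> u (s + T)) has_vector_derivative ?x' (t + T) - ?\<Phi>' (t + T)) (at t within {- T..})"
      by (rule has_vector_derivative_shift_within) auto
    then have "(zeta x u has_vector_derivative E (- T) *v (?x' (t + T) - ?\<Phi>' (t + T))) (at t within {- T..})"
      unfolding zeta_def[abs_def]
      by (rule bounded_linear.has_vector_derivative[OF matrix_vector_mul_bounded_linear])
    also have "?x' (t + T) - ?\<Phi>' (t + T) = A *v (x (t + T) - \<Phi> u (t + T)) + E T *v (B *v u t)"
      by (simp add: matrix_vector_simps)
    also have "E (- T) *v \<dots> = A *v zeta x u t + B *v u t"
    proof -
      have "E (- T) *v (A *v v) = A *v (E (- T) *v v)" for v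
        by (simp only: matrix_vector_mul_assoc mexp_commute)
      then show ?thesis by (simp only: matrix_vector_right_distrib E_cancel zeta_def)
    qed
    finally show ?thesis .
  qed
  ultimately show ?thesis by blast
qed

text \<open>The reading of the equation with \<open>u\<close> as forcing. It serves on the initial
  window, where \<open>u\<close> is given and the residual still has to be estimated.\<close>

lemma zeta_open_loop:
  assumes cl: "cl x u" and "- T \<le> a" "a \<le> b"
  shows "((\<lambda>s. E (b - s) *v (B *v u s)) has_integral (zeta x u b - E (b - a) *v zeta x u a)) {a..b}"
proof -
  obtain D where "\<And>b. finite (D \<inter> {- T..b})"
    "\<And>t. t \<in> {- T..} - D \<Longrightarrow> (zeta x u has_vector_derivative (A *v zeta x u t + B *v u t)) (at t within {- T..})"
    using zeta_derivative[OF cl] by blast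
  from variation_of_constants_Ici[OF zeta_continuous[OF cl] this assms(2,3)] show ?thesis .
qed

text \<open>The same equation with \<open>B ** F\<close> moved into the system matrix: now the
  Hurwitz matrix governs and the residual is the forcing.\<close>

lemma zeta_closed_loop:
  assumes cl: "cl x u" and "- T \<le> a" "a \<le> b"
  shows "((\<lambda>s. G (b - s) *v (B *v residual x u s)) has_integral (zeta x u b - G (b - a) *v zeta x u a)) {a..b}"
proof -
  have eq: "A *v zeta x u t + B *v u t = (A + B ** F) *v zeta x u t + B *v residual x u t" for t
    by (simp add: residual_def matrix_vector_simps matrix_vector_mul_assoc)
  obtain D where "\<And>b. finite (D \<inter> {- T..b})"
    "\<And>t. t \<in> {- T..} - D \<Longrightarrow>
      (zeta x u has_vector_derivative ((A + B ** F) *v zeta x u t + B *v residual x u t)) (at t within {- T..})"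
    using zeta_derivative[OF cl] unfolding eq by blast
  from variation_of_constants_Ici[OF zeta_continuous[OF cl] this assms(2,3)] show ?thesis .
qed

lemma residual_pw_cont:
  assumes "cl x u"
  shows "pw_cont (- T) (residual x u)"
proof -
  have "pw_cont (- T) (\<lambda>t. u t + - (F *v zeta x u t))"
    by (intro pw_cont_add closed_loop_solution_pw_cont[OF assms] continuous_imp_pw_cont
        continuous_intros zeta_continuous[OF assms])
  then show ?thesis unfolding residual_def[abs_def] by simp
qed

lemma residual_integral_delay_solution:
  assumes cl: "cl x u"
  shows "ids (residual x u)"
  unfolding integral_delay_solution_def
proof (intro conjI allI impI)
  show "piecewise_continuous_on (- T) b (residual x u)" for b
    using residual_pw_cont[OF cl] by (simp add: pw_cont_def)
  fix t :: real assume t: "t \<ge> 0"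
  have "integral {t - T..t} (\<lambda>s. G (t - s) *v (B *v residual x u s))
      = zeta x u t - G (t - (t - T)) *v zeta x u (t - T)"
    by (rule integral_unique[OF zeta_closed_loop[OF cl]]) (use t T_nonneg in auto)
  then show "residual x u t = - (F *v integral {t - T..t} (\<lambda>s. G (t - s) *v (B *v residual x u s)))"
    using closed_loop_solution_u[OF cl t] by (simp add: residual_def matrix_vector_simps)
qed

text \<open>No equation has to be solved: \<open>z\<close> is given by variation of constants,
  \<open>u\<close> inverts the definition of the residual and \<open>x\<close> that of
  \<open>zeta\<close>. Starting \<open>z\<close> at zero lets the initial data of
  \<open>(x, u)\<close> be bounded by the history of \<rho> alone.\<close>

lemma ex_closed_loop_solution:
  assumes ids: "ids \<rho>"
  shows "\<exists>x u. cl x u \<and> zeta x u (- T) = 0 \<and> (\<forall>t\<ge>- T. residual x u t = \<rho> t)"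
proof -
  have \<rho>: "pw_cont (- T) \<rho>"
    using ids[unfolded integral_delay_solution_def, THEN conjunct1] unfolding pw_cont_iff[of _ _ 0] .
  let ?w = "\<lambda>s. G (- s) *v (B *v \<rho> s)"
  define z where "z t = G t *v integral {- T..t} ?w" for t
  define u where "u t = \<rho> t + F *v z t" for t
  define x where "x t = E T *v z (t - T) + \<Phi> u t" for t
  have w: "pw_cont (- T) ?w" by (rule pw_cont_weighted[OF \<rho>])
  have z: "continuous_on {- T..} z"
    unfolding z_def[abs_def] by (intro continuous_intros pw_cont_continuous_integral w)
  have u: "pw_cont (- T) u"
    unfolding u_def[abs_def] by (intro pw_cont_add \<rho> continuous_imp_pw_cont continuous_intros z)
  let ?S = "disc_set (- T) \<rho>"
  have S: "finite (?S \<inter> {- T..b})" for b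
    by (rule finite_subset[OF _ finite_disc_set[OF \<rho>, of b]]) auto
  have z': "(z has_vector_derivative ((A + B ** F) *v z t + B *v \<rho> t)) (at t within {- T..})"
    if t: "t \<in> {- T..} - ?S" for t
  proof -
    have "t \<notin> disc_set (- T) ?w" using t disc_set_weighted by blast
    with t have 2: "((\<lambda>t. integral {- T..t} ?w) has_vector_derivative ?w t) (at t within {- T..})"
      by (intro pw_cont_antiderivative w) auto
    have 1: "(G has_vector_derivative (A + B ** F) ** G t) (at t within {- T..})"
      by (rule mexp_has_vector_derivative)
    have "G t *v ?w t = B *v \<rho> t"
      unfolding mexp_add_vec by simp
    with bounded_bilinear.has_vector_derivative[OF bounded_bilinear_matrix_vector_mult 1 2]
    show ?thesis
      by (simp add: z_def[abs_def] matrix_vector_mul_assoc[symmetric] add.commute)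
  qed
  have z_A: "(A + B ** F) *v z t + B *v \<rho> t = A *v z t + B *v u t" for t
    by (simp add: u_def matrix_vector_simps matrix_vector_mul_assoc[symmetric])
  \<comment> \<open>The window integral equals \<open>z t - G T *v z (t - T)\<close>, and by the
    delay equation \<open>F\<close> maps it to \<open>- \<rho> t\<close>; adding
    \<open>F *v z t\<close> to \<rho> leaves the feedback value.\<close>
  have u_eq: "u t = F *v (G T *v z (t - T))" if t: "t \<ge> 0" for t
  proof -
    have "integral {t - T..t} (\<lambda>s. G (t - s) *v (B *v \<rho> s)) = z t - G (t - (t - T)) *v z (t - T)"
      by (rule integral_unique[OF variation_of_constants_Ici[OF z S z']]) (use t T_nonneg in auto)
    moreover have "\<rho> t = - (F *v integral {t - T..t} (\<lambda>s. G (t - s) *v (B *v \<rho> s)))"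
      by (rule ids[unfolded integral_delay_solution_def, THEN conjunct2, rule_format, OF t])
    ultimately show ?thesis by (simp add: u_def matrix_vector_simps)
  qed
  have zeta: "zeta x u t = z t" for t
    by (simp only: zeta_def x_def add_diff_cancel E_cancel add_diff_cancel_right')
  have "cl x u"
    unfolding closed_loop_solution_def
  proof (intro conjI allI impI ballI)
    show "continuous_on {0..} x"
      unfolding x_def[abs_def]
      by (intro continuous_intros predictor_term_continuous u continuous_on_compose2[OF z]) auto
    show "piecewise_continuous_on (- T) b u" for b using u by (simp add: pw_cont_def)
    obtain D where D: "\<And>b. finite (D \<inter> {0..b})"
      and \<Phi>': "\<And>t. t \<in> {0..} - D \<Longrightarrow> (\<Phi> u has_vector_derivative
        (A *v \<Phi> u t + (\<Sum>i = 1..3. Bi i *v u (t - h i)) - E T *v (B *v u (t - T)))) (at t within {0..})"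
      using predictor_term_derivative[OF u] by blast
    \<comment> \<open>Both parts of \<open>x\<close> contribute: the points where
      \<open>\<Phi> u\<close> may fail to be differentiable, and the jumps of \<rho>, which reach
      \<open>x\<close> through \<open>z (t - T)\<close> after time \<open>T\<close>.\<close>
    let ?D = "D \<union> (\<lambda>s. s + T) ` ?S"
    have "finite (?D \<inter> {0..b})" for b
    proof -
      have "?D \<inter> {0..b} \<subseteq> D \<inter> {0..b} \<union> (\<lambda>s. s + T) ` (?S \<inter> {- T..b})"
        using T_nonneg by auto
      then show ?thesis by (rule finite_subset) (use D S in auto)
    qed
    moreover have "(x has_vector_derivative (A *v x t + (\<Sum>i = 1..3. Bi i *v u (t - h i)))) (at t within {0..})"
      if t: "t \<in> {0..} - ?D" for t
    proof -
      have "t + - T \<notin> ?S"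
      proof
        assume "t + - T \<in> ?S"
        then have "t \<in> (\<lambda>s. s + T) ` ?S" by (intro image_eqI[of _ _ "t + - T"]) auto
        with t show False by simp
      qed
      with t have "((\<lambda>t. z (t + - T)) has_vector_derivative (A *v z (t + - T) + B *v u (t + - T))) (at t within {0..})"
        unfolding z_A[symmetric]
        by (intro has_vector_derivative_shift_within[OF z']) auto
      then have "((\<lambda>t. E T *v z (t - T)) has_vector_derivative
          E T *v (A *v z (t - T) + B *v u (t - T))) (at t within {0..})"
        by (simp add: bounded_linear.has_vector_derivative[OF matrix_vector_mul_bounded_linear])
      also have "E T *v (A *v z (t - T) + B *v u (t - T)) = A *v (E T *v z (t - T)) + E T *v (B *v u (t - T))"
        by (simp add: matrix_vector_right_distrib matrix_vector_mul_assoc mexp_commute)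
      finally have "(x has_vector_derivative (A *v (E T *v z (t - T)) + E T *v (B *v u (t - T)) +
          (A *v \<Phi> u t + (\<Sum>i = 1..3. Bi i *v u (t - h i)) - E T *v (B *v u (t - T))))) (at t within {0..})"
        unfolding x_def[abs_def] using t by (intro has_vector_derivative_add \<Phi>') auto
      then show ?thesis by (simp add: x_def matrix_vector_right_distrib algebra_simps)
    qed
    ultimately show "\<exists>D. (\<forall>b. finite (D \<inter> {0..b})) \<and> (\<forall>t\<in>{0..} - D.
        (x has_vector_derivative (A *v x t + (\<Sum>i = 1..3. Bi i *v u (t - h i)))) (at t within {0..}))"
      by blast
    show "u t = (F ** G T ** E (- T)) *v (x t - \<Phi> u t)" if "0 \<le> t" for t
      using u_eq[OF that] by (simp only: x_def matrix_vector_mul_assoc[symmetric] add_diff_cancel E_cancel add_diff_cancel_right')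
  qed
  moreover have "zeta x u (- T) = 0" by (simp add: zeta z_def)
  moreover have "residual x u t = \<rho> t" for t by (simp add: residual_def zeta u_def)
  ultimately show ?thesis by blast
qed

section \<open>Uniform estimates between the residual and the pair \<open>(x, u)\<close>\<close>

lemma zeta_decay_bound:
  obtains K \<gamma> where "K > 0" "\<gamma> > 0" "\<And>x u a b m. cl x u \<Longrightarrow> - T \<le> a \<Longrightarrow> a \<le> b \<Longrightarrow>
     (\<And>s. s \<in> {a..b} \<Longrightarrow> norm (residual x u s) \<le> m) \<Longrightarrow>
     norm (zeta x u b) \<le> K * exp (- \<gamma> * (b - a)) * norm (zeta x u a) + K * m"
proof -
  obtain K \<gamma> where K: "K > 0" "\<gamma> > 0" "\<And>t v. t \<ge> 0 \<Longrightarrow> norm (G t *v v) \<le> K * exp (- \<gamma> * t) * norm v"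
    using hurwitz_imp_mexp_decay[OF hurwitz_closed] by blast
  obtain L where L: "L > 0" "\<And>v. norm (B *v v) \<le> L * norm v"
    using matrix_vector_mult_bound by blast
  \<comment> \<open>\<open>K * L / \<gamma>\<close> bounds the total mass of the decaying kernel,
    and one sum covers both coefficients. The start \<open>a\<close> is left free: boundedness takes
    \<open>a = - T\<close>, whereas convergence restarts at a late time, once the residual is
    small.\<close>
  have bound: "norm (zeta x u b) \<le> (K + K * L / \<gamma>) * exp (- \<gamma> * (b - a)) * norm (zeta x u a) + (K + K * L / \<gamma>) * m"
    if cl: "cl x u" and ab: "- T \<le> a" "a \<le> b" and m: "\<And>s. s \<in> {a..b} \<Longrightarrow> norm (residual x u s) \<le> m"
    for x u a b m
  proof -
    let ?f = "\<lambda>s. G (b - s) *v (B *v residual x u s)"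
    have m0: "0 \<le> m" using order_trans[OF norm_ge_zero m[of a]] ab by simp
    note int = zeta_closed_loop[OF cl ab]
    have g: "((\<lambda>s. K * L * m * exp (- \<gamma> * (b - s))) has_integral (K * L * m * ((1 - exp (- \<gamma> * (b - a))) / \<gamma>))) {a..b}"
      by (rule has_integral_mult_right[OF has_integral_exp_decay[OF ab(2) K(2)]])
    have "norm (integral {a..b} ?f) \<le> integral {a..b} (\<lambda>s. K * L * m * exp (- \<gamma> * (b - s)))"
    proof (rule integral_norm_bound_integral)
      fix s assume s: "s \<in> {a..b}"
      have "norm (?f s) \<le> K * exp (- \<gamma> * (b - s)) * norm (B *v residual x u s)"
        using s by (intro K(3)) auto
      also have "\<dots> \<le> K * exp (- \<gamma> * (b - s)) * (L * m)"
        using K(1) L(1) order_trans[OF L(2) mult_left_mono[OF m[OF s], of L]]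
        by (intro mult_left_mono) auto
      finally show "norm (?f s) \<le> K * L * m * exp (- \<gamma> * (b - s))" by (simp add: mult_ac)
    qed (use int g in \<open>auto simp: integrable_on_def\<close>)
    also have "\<dots> = K * L * m * ((1 - exp (- \<gamma> * (b - a))) / \<gamma>)"
      by (rule integral_unique[OF g])
    also have "\<dots> \<le> K * L * m * (1 / \<gamma>)"
      using K L m0 by (intro mult_left_mono divide_right_mono) auto
    finally have 1: "norm (zeta x u b - G (b - a) *v zeta x u a) \<le> K * L / \<gamma> * m"
      by (simp add: integral_unique[OF int])
    have 2: "norm (G (b - a) *v zeta x u a) \<le> K * exp (- \<gamma> * (b - a)) * norm (zeta x u a)"
      using ab by (intro K(3)) auto
    have "norm (zeta x u b) \<le> K * exp (- \<gamma> * (b - a)) * norm (zeta x u a) + K * L / \<gamma> * m"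
      using 1 2 norm_triangle_ineq2[of "zeta x u b" "G (b - a) *v zeta x u a"] by linarith
    also have "\<dots> \<le> (K + K * L / \<gamma>) * exp (- \<gamma> * (b - a)) * norm (zeta x u a) + (K + K * L / \<gamma>) * m"
      using K L m0 by (intro add_mono mult_right_mono) auto
    finally show ?thesis .
  qed
  have "K + K * L / \<gamma> > 0" using K L by (simp add: add_pos_pos)
  from that[OF this K(2) bound] show thesis .
qed

text \<open>At \<open>- T\<close> the shifted state is \<open>z(0)\<close>, formed from
  \<open>x 0\<close> and the predictor term at time 0, whose window is the given history.\<close>

lemma zeta_initial_bound:
  obtains K where "K > 0" "\<And>x u m. cl x u \<Longrightarrow> norm (x 0) \<le> m \<Longrightarrow> (\<And>s. s \<in> {- T..<0} \<Longrightarrow> norm (u s) \<le> m) \<Longrightarrow>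
     norm (zeta x u (- T)) \<le> K * m"
proof -
  obtain K1 where K1: "K1 > 0" "\<And>u t m. pw_cont (- T) u \<Longrightarrow> t \<ge> 0 \<Longrightarrow> m \<ge> 0 \<Longrightarrow>
      (\<And>s. s \<in> {t - T..<t} \<Longrightarrow> norm (u s) \<le> m) \<Longrightarrow> norm (\<Phi> u t) \<le> K1 * m"
    using predictor_term_bound by blast
  obtain L where L: "L > 0" "\<And>v. norm (E (- T) *v v) \<le> L * norm v"
    using matrix_vector_mult_bound by blast
  have bound: "norm (zeta x u (- T)) \<le> L * (1 + K1) * m"
    if cl: "cl x u" and x0: "norm (x 0) \<le> m" and u: "\<And>s. s \<in> {- T..<0} \<Longrightarrow> norm (u s) \<le> m" for x u m
  proof -
    have m0: "m \<ge> 0" using order_trans[OF norm_ge_zero x0] .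
    have "norm (\<Phi> u 0) \<le> K1 * m"
      by (rule K1(2)[OF closed_loop_solution_pw_cont[OF cl]]) (use m0 u in auto)
    then have "norm (x 0 - \<Phi> u 0) \<le> (1 + K1) * m"
      using x0 norm_triangle_ineq4[of "x 0" "\<Phi> u 0"] by (simp add: distrib_right)
    from order_trans[OF L(2) mult_left_mono[OF this, of L]] L(1)
    show ?thesis by (simp add: zeta_def mult_ac)
  qed
  have "L * (1 + K1) > 0" using K1 L by simp
  from that[OF this bound] show thesis .
qed

text \<open>The residual on \<open>[-T, 0)\<close> is not prescribed but contains
  \<open>zeta\<close>, which the open-loop equation determines from \<open>zeta x u (- T)\<close>
  and the history of \<open>u\<close>. In \<open>c\<close>, the summand 1 stands for
  \<open>u\<close> itself and the rest for \<open>F *v zeta x u t\<close>.\<close>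

lemma residual_history_bound:
  obtains K where "K > 0" "\<And>x u m t. cl x u \<Longrightarrow> norm (x 0) \<le> m \<Longrightarrow> (\<And>s. s \<in> {- T..<0} \<Longrightarrow> norm (u s) \<le> m) \<Longrightarrow>
     t \<in> {- T..<0} \<Longrightarrow> norm (residual x u t) \<le> K * m"
proof -
  obtain K0 where K0: "K0 > 0" "\<And>x u m. cl x u \<Longrightarrow> norm (x 0) \<le> m \<Longrightarrow> (\<And>s. s \<in> {- T..<0} \<Longrightarrow> norm (u s) \<le> m) \<Longrightarrow>
     norm (zeta x u (- T)) \<le> K0 * m"
    using zeta_initial_bound by blast
  obtain K where K: "K > 0" "\<And>s v. s \<in> {- T..T} \<Longrightarrow> norm (E s *v v) \<le> K * norm v"
    using mexp_compact_bound by blast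
  obtain L where L: "L > 0" "\<And>v. norm (B *v v) \<le> L * norm v"
    using matrix_vector_mult_bound by blast
  obtain L' where L': "L' > 0" "\<And>v. norm (F *v v) \<le> L' * norm v"
    using matrix_vector_mult_bound by blast
  define c where "c = 1 + L' * (K * K0 + K * L * T)"
  have bound: "norm (residual x u t) \<le> c * m"
    if cl: "cl x u" and x0: "norm (x 0) \<le> m" and u: "\<And>s. s \<in> {- T..<0} \<Longrightarrow> norm (u s) \<le> m"
      and t: "t \<in> {- T..<0}" for x u m t
  proof -
    have m0: "m \<ge> 0" using order_trans[OF norm_ge_zero x0] .
    have "norm (zeta x u t - E (t - - T) *v zeta x u (- T)) \<le> K * (L * m) * measure lborel (cbox (- T) t)"
    proof (rule has_integral_bound)
      show "((\<lambda>s. E (t - s) *v (B *v u s)) has_integral (zeta x u t - E (t - - T) *v zeta x u (- T))) (cbox (- T) t)"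
        using zeta_open_loop[OF cl, of "- T" t] t by simp
      fix s assume s: "s \<in> cbox (- T) t"
      have "norm (E (t - s) *v (B *v u s)) \<le> K * norm (B *v u s)"
        using s t by (intro K) auto
      also have "\<dots> \<le> K * (L * m)"
        using K(1) L(1) s t order_trans[OF L(2) mult_left_mono[OF u, of s L]]
        by (intro mult_left_mono) auto
      finally show "norm (E (t - s) *v (B *v u s)) \<le> K * (L * m)" .
    qed (use K L m0 in auto)
    also have "\<dots> \<le> K * (L * m) * T"
      using t K L m0 by (intro mult_left_mono) auto
    finally have 1: "norm (zeta x u t - E (t - - T) *v zeta x u (- T)) \<le> K * L * T * m"
      by (simp add: mult_ac)
    have "norm (E (t - - T) *v zeta x u (- T)) \<le> K * norm (zeta x u (- T))"
      using t by (intro K) auto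
    also have "\<dots> \<le> K * (K0 * m)"
      using K(1) by (intro mult_left_mono K0(2) cl x0 u) auto
    finally have "norm (zeta x u t) \<le> (K * K0 + K * L * T) * m"
      using 1 norm_triangle_ineq2[of "zeta x u t" "E (t - - T) *v zeta x u (- T)"]
      by (simp add: algebra_simps)
    from order_trans[OF L'(2) mult_left_mono[OF this, of L']] L'(1)
    have "norm (F *v zeta x u t) \<le> L' * ((K * K0 + K * L * T) * m)" by simp
    with u[OF t] norm_triangle_ineq4[of "u t" "F *v zeta x u t"]
    show ?thesis by (simp add: residual_def c_def distrib_right mult.assoc)
  qed
  have "c > 0" using K K0 L L' T_nonneg by (simp add: c_def add_pos_nonneg)
  from that[OF this bound] show thesis .
qed

text \<open>Control passes from the residual on \<open>[-T, \<infinity>)\<close> to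
  \<open>zeta\<close> by Hurwitz decay, from \<open>zeta\<close> to \<open>u\<close> by the feedback
  law, and from both to \<open>x\<close>; \<open>cz\<close>, \<open>cu\<close> and \<open>cx\<close>
  are the factors of these three stages. The 1 in \<open>cu\<close> covers the history of
  \<open>u\<close>, the one in \<open>K1 + 1\<close> the residual at nonnegative times.\<close>

lemma closed_loop_bound:
  obtains K where "K > 0" "\<And>x u m t. cl x u \<Longrightarrow> norm (x 0) \<le> m \<Longrightarrow> (\<And>s. s \<in> {- T..<0} \<Longrightarrow> norm (u s) \<le> m) \<Longrightarrow>
     (\<And>s. s \<ge> 0 \<Longrightarrow> norm (residual x u s) \<le> m) \<Longrightarrow> t \<ge> 0 \<Longrightarrow> norm (x t) \<le> K * m \<and> norm (u t) \<le> K * m"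
proof -
  obtain K0 where K0: "K0 > 0" "\<And>x u m. cl x u \<Longrightarrow> norm (x 0) \<le> m \<Longrightarrow> (\<And>s. s \<in> {- T..<0} \<Longrightarrow> norm (u s) \<le> m) \<Longrightarrow>
     norm (zeta x u (- T)) \<le> K0 * m"
    using zeta_initial_bound by blast
  obtain K1 where K1: "K1 > 0" "\<And>x u m t. cl x u \<Longrightarrow> norm (x 0) \<le> m \<Longrightarrow> (\<And>s. s \<in> {- T..<0} \<Longrightarrow> norm (u s) \<le> m) \<Longrightarrow>
     t \<in> {- T..<0} \<Longrightarrow> norm (residual x u t) \<le> K1 * m"
    using residual_history_bound by blast
  obtain K2 \<gamma> where K2: "K2 > 0" "\<gamma> > 0" "\<And>x u a b m. cl x u \<Longrightarrow> - T \<le> a \<Longrightarrow> a \<le> b \<Longrightarrow>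
     (\<And>s. s \<in> {a..b} \<Longrightarrow> norm (residual x u s) \<le> m) \<Longrightarrow>
     norm (zeta x u b) \<le> K2 * exp (- \<gamma> * (b - a)) * norm (zeta x u a) + K2 * m"
    using zeta_decay_bound by blast
  obtain K3 where K3: "K3 > 0" "\<And>u t m. pw_cont (- T) u \<Longrightarrow> t \<ge> 0 \<Longrightarrow> m \<ge> 0 \<Longrightarrow>
      (\<And>s. s \<in> {t - T..<t} \<Longrightarrow> norm (u s) \<le> m) \<Longrightarrow> norm (\<Phi> u t) \<le> K3 * m"
    using predictor_term_bound by blast
  obtain L1 where L1: "L1 > 0" "\<And>v. norm (F *v (G T *v v)) \<le> L1 * norm v"
    using matrix_vector_mult_bound[of "F ** G T"] by (auto simp: matrix_vector_mul_assoc)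
  obtain L2 where L2: "L2 > 0" "\<And>v. norm (E T *v v) \<le> L2 * norm v"
    using matrix_vector_mult_bound by blast
  define cz where "cz = K2 * K0 + K2 * (K1 + 1)"
  define cu where "cu = 1 + L1 * cz"
  define cx where "cx = L2 * cz + K3 * cu"
  have pos: "cz > 0" "cu > 0" "cx > 0"
    using K0 K1 K2 K3 L1 L2 by (simp_all add: cz_def cu_def cx_def add_pos_pos)
  have bound: "norm (x t) \<le> (cx + cu) * m \<and> norm (u t) \<le> (cx + cu) * m"
    if cl: "cl x u" and x0: "norm (x 0) \<le> m" and u: "\<And>s. s \<in> {- T..<0} \<Longrightarrow> norm (u s) \<le> m"
      and r: "\<And>s. s \<ge> 0 \<Longrightarrow> norm (residual x u s) \<le> m" and t: "t \<ge> 0" for x u m t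
  proof -
    have m0: "m \<ge> 0" using order_trans[OF norm_ge_zero x0] .
    have r': "norm (residual x u s) \<le> (K1 + 1) * m" if "s \<ge> - T" for s
    proof (cases "s < 0")
      case True
      with K1(2)[OF cl x0 u, of s] that m0 show ?thesis by (simp add: distrib_right)
    next
      case False
      with r[of s] m0 K1(1) show ?thesis by (simp add: distrib_right add_increasing)
    qed
    have z: "norm (zeta x u s) \<le> cz * m" if s: "s \<ge> - T" for s
    proof -
      have "norm (zeta x u s) \<le> K2 * exp (- \<gamma> * (s - - T)) * norm (zeta x u (- T)) + K2 * ((K1 + 1) * m)"
        by (rule K2(3)[OF cl]) (use s r' in auto)
      also have "K2 * exp (- \<gamma> * (s - - T)) * norm (zeta x u (- T)) \<le> K2 * 1 * (K0 * m)"
        using K2(1,2) s by (intro mult_mono K0(2) cl x0 u) auto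
      finally show ?thesis by (simp add: cz_def algebra_simps)
    qed
    have u': "norm (u s) \<le> cu * m" if s: "s \<ge> - T" for s
    proof (cases "s < 0")
      case True
      have "L1 * cz * m \<ge> 0" using pos L1 m0 by simp
      with u[of s] that True show ?thesis by (simp add: cu_def distrib_right)
    next
      case False
      then have "norm (u s) \<le> L1 * norm (zeta x u (s - T))"
        using closed_loop_solution_u[OF cl, of s] L1(2) by simp
      also have "\<dots> \<le> L1 * (cz * m)" using L1(1) False by (intro mult_left_mono z) auto
      finally show ?thesis using m0 by (simp add: cu_def distrib_right mult.assoc)
    qed
    have "norm (E T *v zeta x u (t - T)) \<le> L2 * (cz * m)"
      using t L2(1) by (intro order_trans[OF L2(2)] mult_left_mono z) auto
    moreover have "norm (\<Phi> u t) \<le> K3 * (cu * m)"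
      by (rule K3(2)[OF closed_loop_solution_pw_cont[OF cl] t]) (use m0 pos t u' in auto)
    ultimately have "norm (x t) \<le> cx * m"
      using norm_triangle_ineq[of "E T *v zeta x u (t - T)" "\<Phi> u t"]
      unfolding closed_loop_solution_x[of x t u] cx_def by (simp add: distrib_right mult.assoc)
    moreover have "norm (u t) \<le> cu * m" using t T_nonneg by (intro u') auto
    moreover have "cx * m \<ge> 0" "cu * m \<ge> 0" using pos m0 by auto
    ultimately show ?thesis by (simp add: distrib_right)
  qed
  have "cx + cu > 0" using pos by simp
  show thesis by (rule that[OF \<open>cx + cu > 0\<close>]) (fact bound)
qed

text \<open>The reverse of \<open>residual_history_bound\<close> for solutions constructed from
  \<rho>: without an initial value of \<open>zeta\<close> the residual controls it alone, hence also
  \<open>u\<close>, and \<open>x 0\<close> reduces to the predictor term. \<open>m \<ge> 0\<close>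
  is stated separately because the history is empty if \<open>T = 0\<close>.\<close>

lemma closed_loop_history_bound:
  obtains K where "K > 0" "\<And>x u m. cl x u \<Longrightarrow> m \<ge> 0 \<Longrightarrow> zeta x u (- T) = 0 \<Longrightarrow>
      (\<And>s. s \<in> {- T..<0} \<Longrightarrow> norm (residual x u s) \<le> m) \<Longrightarrow>
      norm (x 0) \<le> K * m \<and> (\<forall>t\<in>{- T..<0}. norm (u t) \<le> K * m)"
proof -
  obtain K2 \<gamma> where K2: "K2 > 0" "\<gamma> > 0" "\<And>x u a b m. cl x u \<Longrightarrow> - T \<le> a \<Longrightarrow> a \<le> b \<Longrightarrow>
     (\<And>s. s \<in> {a..b} \<Longrightarrow> norm (residual x u s) \<le> m) \<Longrightarrow>
     norm (zeta x u b) \<le> K2 * exp (- \<gamma> * (b - a)) * norm (zeta x u a) + K2 * m"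
    using zeta_decay_bound by blast
  obtain K3 where K3: "K3 > 0" "\<And>u t m. pw_cont (- T) u \<Longrightarrow> t \<ge> 0 \<Longrightarrow> m \<ge> 0 \<Longrightarrow>
      (\<And>s. s \<in> {t - T..<t} \<Longrightarrow> norm (u s) \<le> m) \<Longrightarrow> norm (\<Phi> u t) \<le> K3 * m"
    using predictor_term_bound by blast
  obtain L where L: "L > 0" "\<And>v. norm (F *v v) \<le> L * norm v"
    using matrix_vector_mult_bound by blast
  define c where "c = 1 + L * K2"
  have c: "c > 0" using L K2 by (simp add: c_def add_pos_pos)
  have bound: "norm (x 0) \<le> (K3 * c + c) * m \<and> (\<forall>t\<in>{- T..<0}. norm (u t) \<le> (K3 * c + c) * m)"
    if cl: "cl x u" and m0: "m \<ge> 0" and z: "zeta x u (- T) = 0"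
      and r: "\<And>s. s \<in> {- T..<0} \<Longrightarrow> norm (residual x u s) \<le> m" for x u m
  proof -
    have u: "norm (u t) \<le> c * m" if t: "t \<in> {- T..<0}" for t
    proof -
      have "norm (zeta x u t) \<le> K2 * exp (- \<gamma> * (t - - T)) * norm (zeta x u (- T)) + K2 * m"
        by (rule K2(3)[OF cl]) (use t r in auto)
      then have "norm (zeta x u t) \<le> K2 * m" by (simp add: z)
      from order_trans[OF L(2) mult_left_mono[OF this, of L]] L(1)
      have "norm (F *v zeta x u t) \<le> L * (K2 * m)" by simp
      with r[OF t] norm_triangle_ineq[of "residual x u t" "F *v zeta x u t"]
      show ?thesis by (simp add: residual_def c_def distrib_right mult.assoc)
    qed
    have "x 0 = \<Phi> u 0"
      using closed_loop_solution_x[of x 0 u] z by simp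
    moreover have "norm (\<Phi> u 0) \<le> K3 * (c * m)"
      by (rule K3(2)[OF closed_loop_solution_pw_cont[OF cl]]) (use m0 c u in auto)
    moreover have "K3 * c * m \<ge> 0" "c * m \<ge> 0" using K3(1) c m0 by auto
    ultimately show ?thesis using u by (auto simp: distrib_right mult.assoc intro: add_increasing)
  qed
  have "K3 * c + c > 0" using K3 c by (simp add: add_pos_pos)
  show thesis by (rule that[OF \<open>K3 * c + c > 0\<close>]) (fact bound)
qed

text \<open>Since \<open>zeta x u t\<close> is \<open>z(t + T)\<close>, the estimate looks ahead by
  \<open>T\<close>. It is fed with bounds on \<open>x\<close> and \<open>u\<close> that hold at all
  nonnegative or all late times.\<close>

lemma residual_bound:
  obtains K where "K > 0" "\<And>x u t m. cl x u \<Longrightarrow> t \<ge> 0 \<Longrightarrow> norm (x (t + T)) \<le> m \<Longrightarrow>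
      (\<And>s. s \<in> {t..t + T} \<Longrightarrow> norm (u s) \<le> m) \<Longrightarrow> norm (residual x u t) \<le> K * m"
proof -
  obtain K3 where K3: "K3 > 0" "\<And>u t m. pw_cont (- T) u \<Longrightarrow> t \<ge> 0 \<Longrightarrow> m \<ge> 0 \<Longrightarrow>
      (\<And>s. s \<in> {t - T..<t} \<Longrightarrow> norm (u s) \<le> m) \<Longrightarrow> norm (\<Phi> u t) \<le> K3 * m"
    using predictor_term_bound by blast
  obtain L where L: "L > 0" "\<And>v. norm (F *v (E (- T) *v v)) \<le> L * norm v"
    using matrix_vector_mult_bound[of "F ** E (- T)"] by (auto simp: matrix_vector_mul_assoc)
  have bound: "norm (residual x u t) \<le> (1 + L * (1 + K3)) * m"
    if cl: "cl x u" and t: "t \<ge> 0" and x: "norm (x (t + T)) \<le> m"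
      and u: "\<And>s. s \<in> {t..t + T} \<Longrightarrow> norm (u s) \<le> m" for x u t m
  proof -
    have m0: "m \<ge> 0" using order_trans[OF norm_ge_zero x] .
    have "norm (\<Phi> u (t + T)) \<le> K3 * m"
      by (rule K3(2)[OF closed_loop_solution_pw_cont[OF cl]]) (use t T_nonneg m0 u in auto)
    then have "norm (x (t + T) - \<Phi> u (t + T)) \<le> (1 + K3) * m"
      using x norm_triangle_ineq4[of "x (t + T)" "\<Phi> u (t + T)"] by (simp add: distrib_right)
    from order_trans[OF L(2) mult_left_mono[OF this, of L]] L(1)
    have "norm (F *v zeta x u t) \<le> L * ((1 + K3) * m)" by (simp add: zeta_def)
    moreover have "norm (u t) \<le> m" using T_nonneg by (intro u) auto
    ultimately show ?thesis
      using norm_triangle_ineq4[of "u t" "F *v zeta x u t"]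
      by (simp add: residual_def distrib_right mult.assoc)
  qed
  have "1 + L * (1 + K3) > 0" using L K3 by (simp add: add_pos_pos)
  from that[OF this bound] show thesis .
qed

section \<open>Convergence to zero\<close>

lemma closed_loop_tendsto_0:
  assumes cl: "cl x u" and r: "(residual x u \<longlongrightarrow> 0) at_top"
  shows "(x \<longlongrightarrow> 0) at_top \<and> (u \<longlongrightarrow> 0) at_top"
proof -
  obtain K \<gamma> where K: "K > 0" "\<gamma> > 0" "\<And>x u a b m. cl x u \<Longrightarrow> - T \<le> a \<Longrightarrow> a \<le> b \<Longrightarrow>
     (\<And>s. s \<in> {a..b} \<Longrightarrow> norm (residual x u s) \<le> m) \<Longrightarrow>
     norm (zeta x u b) \<le> K * exp (- \<gamma> * (b - a)) * norm (zeta x u a) + K * m"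
    using zeta_decay_bound by blast
  obtain K3 where K3: "K3 > 0" "\<And>u t m. pw_cont (- T) u \<Longrightarrow> t \<ge> 0 \<Longrightarrow> m \<ge> 0 \<Longrightarrow>
      (\<And>s. s \<in> {t - T..<t} \<Longrightarrow> norm (u s) \<le> m) \<Longrightarrow> norm (\<Phi> u t) \<le> K3 * m"
    using predictor_term_bound by blast
  have "(zeta x u \<longlongrightarrow> 0) at_top"
    unfolding tendsto_zero_at_top_iff
  proof (intro allI impI)
    fix e :: real assume e: "e > 0"
    define m where "m = e / (2 * K)"
    have m: "m > 0" using e K by (simp add: m_def)
    with r obtain N0 where N0: "\<And>s. s \<ge> N0 \<Longrightarrow> norm (residual x u s) < m"
      unfolding tendsto_zero_at_top_iff by blast
    \<comment> \<open>The maximum with 0 places the restart time in the domain of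
      \<open>zeta\<close>. From there the forcing contributes at most \<open>K * m = e / 2\<close>,
      and the transient eventually falls below the other half.\<close>
    define N where "N = max N0 0"
    have "((\<lambda>t. K * exp (- (\<gamma> * (- N + t))) * norm (zeta x u N)) \<longlongrightarrow> 0) at_top"
      by (intro tendsto_mult_left_zero tendsto_mult_right_zero filterlim_compose[OF exp_at_bot]
          filterlim_uminus_at_bot_at_top[THEN filterlim_compose]
          filterlim_tendsto_pos_mult_at_top[OF tendsto_const K(2)]
          filterlim_tendsto_add_at_top[OF tendsto_const] filterlim_ident)
    then obtain N1 where N1: "\<And>t. t \<ge> N1 \<Longrightarrow> norm (K * exp (- (\<gamma> * (- N + t))) * norm (zeta x u N)) < e / 2"
      unfolding tendsto_zero_at_top_iff using half_gt_zero[OF e] by blast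
    have "norm (zeta x u t) < e" if t: "t \<ge> max N N1" for t
    proof -
      have "norm (zeta x u t) \<le> K * exp (- \<gamma> * (t - N)) * norm (zeta x u N) + K * m"
        using t T_nonneg by (intro K(3) cl less_imp_le[OF N0]) (auto simp: N_def)
      also have "K * m = e / 2" using K by (simp add: m_def)
      also have "K * exp (- \<gamma> * (t - N)) * norm (zeta x u N) < e / 2"
        using N1[of t] t K(1) by simp
      finally show ?thesis by simp
    qed
    then show "\<exists>N. \<forall>t\<ge>N. norm (zeta x u t) < e" by blast
  qed
  moreover have "filterlim (\<lambda>t. - T + t) at_top at_top"
    by (intro filterlim_tendsto_add_at_top[OF tendsto_const] filterlim_ident)
  ultimately have z: "((\<lambda>t. zeta x u (- T + t)) \<longlongrightarrow> 0) at_top"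
    by (rule filterlim_compose)
  have "((\<lambda>t. F *v (G T *v zeta x u (- T + t))) \<longlongrightarrow> 0) at_top"
    by (intro bounded_linear.tendsto_zero[OF matrix_vector_mul_bounded_linear] z)
  moreover have "\<forall>\<^sub>F t in at_top. F *v (G T *v zeta x u (- T + t)) = u t"
    using eventually_ge_at_top[of 0] by eventually_elim (simp add: closed_loop_solution_u[OF cl])
  ultimately have u: "(u \<longlongrightarrow> 0) at_top"
    by (rule Lim_transform_eventually)
  have "(\<Phi> u \<longlongrightarrow> 0) at_top"
    unfolding tendsto_zero_at_top_iff
  proof (intro allI impI)
    fix e :: real assume e: "e > 0"
    define m where "m = e / (2 * K3)"
    have m: "m > 0" using e K3 by (simp add: m_def)
    with u obtain N where N: "\<And>s. s \<ge> N \<Longrightarrow> norm (u s) < m"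
      unfolding tendsto_zero_at_top_iff by blast
    have "norm (\<Phi> u t) < e" if t: "t \<ge> max 0 (N + T)" for t
    proof -
      have "norm (\<Phi> u t) \<le> K3 * m"
        using t m by (intro K3(2) closed_loop_solution_pw_cont[OF cl] less_imp_le[OF N]) auto
      also have "\<dots> < e" using K3 e by (simp add: m_def)
      finally show ?thesis .
    qed
    then show "\<exists>N. \<forall>t\<ge>N. norm (\<Phi> u t) < e" by blast
  qed
  with z have "((\<lambda>t. E T *v zeta x u (- T + t) + \<Phi> u t) \<longlongrightarrow> 0) at_top"
    by (intro tendsto_add_zero bounded_linear.tendsto_zero[OF matrix_vector_mul_bounded_linear])
  moreover have "(\<lambda>t. E T *v zeta x u (- T + t) + \<Phi> u t) = x"
    by (rule ext) (simp add: closed_loop_solution_x[of x _ u])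
  ultimately show ?thesis using u by simp
qed

lemma residual_tendsto_0:
  assumes cl: "cl x u" and x: "(x \<longlongrightarrow> 0) at_top" and u: "(u \<longlongrightarrow> 0) at_top"
  shows "(residual x u \<longlongrightarrow> 0) at_top"
  unfolding tendsto_zero_at_top_iff
proof (intro allI impI)
  obtain K where K: "K > 0" "\<And>x u t m. cl x u \<Longrightarrow> t \<ge> 0 \<Longrightarrow> norm (x (t + T)) \<le> m \<Longrightarrow>
      (\<And>s. s \<in> {t..t + T} \<Longrightarrow> norm (u s) \<le> m) \<Longrightarrow> norm (residual x u t) \<le> K * m"
    using residual_bound by blast
  fix e :: real assume e: "e > 0"
  define m where "m = e / (2 * K)"
  have m: "m > 0" using e K by (simp add: m_def)
  obtain N1 where N1: "\<And>s. s \<ge> N1 \<Longrightarrow> norm (x s) < m"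
    using x m unfolding tendsto_zero_at_top_iff by blast
  obtain N2 where N2: "\<And>s. s \<ge> N2 \<Longrightarrow> norm (u s) < m"
    using u m unfolding tendsto_zero_at_top_iff by blast
  have "norm (residual x u t) < e" if t: "t \<ge> max 0 (max N1 N2)" for t
  proof -
    have "norm (residual x u t) \<le> K * m"
      using t T_nonneg by (intro K(2) cl less_imp_le[OF N1] less_imp_le[OF N2]) auto
    also have "\<dots> < e" using K e by (simp add: m_def)
    finally show ?thesis .
  qed
  then show "\<exists>N. \<forall>t\<ge>N. norm (residual x u t) < e" by blast
qed

section \<open>The two implications\<close>

lemma integral_delay_stable_imp_closed_loop_stable:
  assumes "integral_delay_asymptotically_stable A T B F"
  shows "closed_loop_asymptotically_stable A Bi h T B F"
proof -
  obtain K1 where K1: "K1 > 0" "\<And>x u m t. cl x u \<Longrightarrow> norm (x 0) \<le> m \<Longrightarrow> (\<And>s. s \<in> {- T..<0} \<Longrightarrow> norm (u s) \<le> m) \<Longrightarrow>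
     t \<in> {- T..<0} \<Longrightarrow> norm (residual x u t) \<le> K1 * m"
    using residual_history_bound by blast
  obtain K2 where K2: "K2 > 0" "\<And>x u m t. cl x u \<Longrightarrow> norm (x 0) \<le> m \<Longrightarrow> (\<And>s. s \<in> {- T..<0} \<Longrightarrow> norm (u s) \<le> m) \<Longrightarrow>
     (\<And>s. s \<ge> 0 \<Longrightarrow> norm (residual x u s) \<le> m) \<Longrightarrow> t \<ge> 0 \<Longrightarrow> norm (x t) \<le> K2 * m \<and> norm (u t) \<le> K2 * m"
    using closed_loop_bound by blast
  have small: "norm (residual x u t) < d"
    if d: "d > 0" and cl: "cl x u" and x0: "norm (x 0) < d / (2 * K1)"
      and u: "\<And>s. s \<in> {- T..<0} \<Longrightarrow> norm (u s) < d / (2 * K1)" and t: "t \<in> {- T..<0}" for x u t d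
  proof -
    have "norm (residual x u t) \<le> K1 * (d / (2 * K1))"
      by (rule K1(2)[OF cl _ _ t]) (use x0 u in \<open>auto intro: less_imp_le\<close>)
    also have "\<dots> < d" using K1 d by simp
    finally show ?thesis .
  qed
  show ?thesis
    unfolding closed_loop_asymptotically_stable_def
  proof (intro conjI allI impI)
    fix \<epsilon> :: real assume \<epsilon>: "\<epsilon> > 0"
    \<comment> \<open>The estimates are non-strict while stability asks for strict inequalities; the
      factor 2 bridges the gap, here and in \<open>d / (2 * K1)\<close>.\<close>
    define m where "m = \<epsilon> / (2 * K2)"
    have m: "m > 0" using \<epsilon> K2 by (simp add: m_def)
    with assms obtain d where d: "d > 0"
      and st: "\<And>\<rho> t. ids \<rho> \<Longrightarrow> (\<And>\<theta>. \<theta> \<in> {- T..<0} \<Longrightarrow> norm (\<rho> \<theta>) < d) \<Longrightarrow> t \<ge> 0 \<Longrightarrow> norm (\<rho> t) < m"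
      unfolding integral_delay_asymptotically_stable_def by metis
    \<comment> \<open>Of the two bounds on the data, \<open>d / (2 * K1)\<close> makes the history
      of the residual smaller than \<open>d\<close>, so that stability of the delay equation
      applies; \<open>m\<close> is the bound that \<open>closed_loop_bound\<close> requires of the
      data themselves.\<close>
    have "norm (x t) < \<epsilon> \<and> norm (u t) < \<epsilon>"
      if cl: "cl x u" and x0: "norm (x 0) < min m (d / (2 * K1))"
        and u: "\<And>\<theta>. \<theta> \<in> {- T..<0} \<Longrightarrow> norm (u \<theta>) < min m (d / (2 * K1))" and t: "t \<ge> 0" for x u t
    proof -
      have "norm (residual x u s) < m" if "s \<ge> 0" for s
        by (rule st[OF residual_integral_delay_solution[OF cl] small[OF d cl]]) (use x0 u that in auto)
      then have "norm (x t) \<le> K2 * m \<and> norm (u t) \<le> K2 * m"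
        using x0 u t by (intro K2(2) cl) (auto intro: less_imp_le)
      moreover have "K2 * m < \<epsilon>" using K2 \<epsilon> by (simp add: m_def)
      ultimately show ?thesis by auto
    qed
    moreover have "min m (d / (2 * K1)) > 0" using m d K1 by simp
    ultimately show "\<exists>\<delta>>0. \<forall>x u. cl x u \<and> norm (x 0) < \<delta> \<and> (\<forall>\<theta>\<in>{- T..<0}. norm (u \<theta>) < \<delta>) \<longrightarrow>
        (\<forall>t\<ge>0. norm (x t) < \<epsilon> \<and> norm (u t) < \<epsilon>)"
      by blast
  next
    obtain d where d: "d > 0"
      and at: "\<And>\<rho>. ids \<rho> \<Longrightarrow> (\<And>\<theta>. \<theta> \<in> {- T..<0} \<Longrightarrow> norm (\<rho> \<theta>) < d) \<Longrightarrow> (\<rho> \<longlongrightarrow> 0) at_top"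
      using assms unfolding integral_delay_asymptotically_stable_def by metis
    have "(x \<longlongrightarrow> 0) at_top \<and> (u \<longlongrightarrow> 0) at_top"
      if cl: "cl x u" and x0: "norm (x 0) < d / (2 * K1)"
        and u: "\<And>\<theta>. \<theta> \<in> {- T..<0} \<Longrightarrow> norm (u \<theta>) < d / (2 * K1)" for x u
      by (intro closed_loop_tendsto_0 cl at residual_integral_delay_solution small d x0 u)
    moreover have "d / (2 * K1) > 0" using d K1 by simp
    ultimately show "\<exists>\<delta>>0. \<forall>x u. cl x u \<and> norm (x 0) < \<delta> \<and> (\<forall>\<theta>\<in>{- T..<0}. norm (u \<theta>) < \<delta>) \<longrightarrow>
        (x \<longlongrightarrow> 0) at_top \<and> (u \<longlongrightarrow> 0) at_top"
      by blast
  qed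
qed

lemma closed_loop_stable_imp_integral_delay_stable:
  assumes "closed_loop_asymptotically_stable A Bi h T B F"
  shows "integral_delay_asymptotically_stable A T B F"
proof -
  obtain K1 where K1: "K1 > 0" "\<And>x u m. cl x u \<Longrightarrow> m \<ge> 0 \<Longrightarrow> zeta x u (- T) = 0 \<Longrightarrow>
      (\<And>s. s \<in> {- T..<0} \<Longrightarrow> norm (residual x u s) \<le> m) \<Longrightarrow>
      norm (x 0) \<le> K1 * m \<and> (\<forall>t\<in>{- T..<0}. norm (u t) \<le> K1 * m)"
    using closed_loop_history_bound by metis
  obtain K2 where K2: "K2 > 0" "\<And>x u t m. cl x u \<Longrightarrow> t \<ge> 0 \<Longrightarrow> norm (x (t + T)) \<le> m \<Longrightarrow>
      (\<And>s. s \<in> {t..t + T} \<Longrightarrow> norm (u s) \<le> m) \<Longrightarrow> norm (residual x u t) \<le> K2 * m"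
    using residual_bound by blast
  \<comment> \<open>Every solution \<rho> with small history is the residual of a closed-loop
    solution with small initial data, so the assumed stability applies to that solution and returns
    to \<rho> through \<open>residual_bound\<close> or \<open>residual_tendsto_0\<close>.\<close>
  have small: "\<exists>x u. cl x u \<and> norm (x 0) < d \<and> (\<forall>\<theta>\<in>{- T..<0}. norm (u \<theta>) < d) \<and> (\<forall>t\<ge>0. residual x u t = \<rho> t)"
    if d: "d > 0" and ids: "ids \<rho>" and \<rho>: "\<And>\<theta>. \<theta> \<in> {- T..<0} \<Longrightarrow> norm (\<rho> \<theta>) < d / (2 * K1)" for \<rho> d
  proof -
    obtain x u where cl: "cl x u" and z: "zeta x u (- T) = 0" and r: "\<And>t. t \<ge> - T \<Longrightarrow> residual x u t = \<rho> t"
      using ex_closed_loop_solution[OF ids] by blast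
    have "norm (x 0) \<le> K1 * (d / (2 * K1)) \<and> (\<forall>t\<in>{- T..<0}. norm (u t) \<le> K1 * (d / (2 * K1)))"
      by (rule K1(2)[OF cl _ z]) (use d K1 \<rho> r in \<open>auto intro: less_imp_le\<close>)
    moreover have "K1 * (d / (2 * K1)) < d" using K1 d by simp
    ultimately have "norm (x 0) < d" "\<And>\<theta>. \<theta> \<in> {- T..<0} \<Longrightarrow> norm (u \<theta>) < d"
      using le_less_trans by blast+
    moreover have "residual x u t = \<rho> t" if "t \<ge> 0" for t using that T_nonneg by (intro r) auto
    ultimately show ?thesis using cl by blast
  qed
  show ?thesis
    unfolding integral_delay_asymptotically_stable_def
  proof (intro conjI allI impI)
    fix \<epsilon> :: real assume \<epsilon>: "\<epsilon> > 0"
    define m where "m = \<epsilon> / (2 * K2)"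
    have m: "m > 0" using \<epsilon> K2 by (simp add: m_def)
    with assms obtain d where d: "d > 0"
      and st: "\<And>x u t. cl x u \<Longrightarrow> norm (x 0) < d \<Longrightarrow> (\<And>\<theta>. \<theta> \<in> {- T..<0} \<Longrightarrow> norm (u \<theta>) < d) \<Longrightarrow> t \<ge> 0 \<Longrightarrow>
        norm (x t) < m \<and> norm (u t) < m"
      unfolding closed_loop_asymptotically_stable_def by metis
    have "norm (\<rho> t) < \<epsilon>"
      if ids: "ids \<rho>" and \<rho>: "\<And>\<theta>. \<theta> \<in> {- T..<0} \<Longrightarrow> norm (\<rho> \<theta>) < d / (2 * K1)" and t: "t \<ge> 0" for \<rho> t
    proof -
      obtain x u where cl: "cl x u" and x0: "norm (x 0) < d" and u: "\<And>\<theta>. \<theta> \<in> {- T..<0} \<Longrightarrow> norm (u \<theta>) < d"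
        and r: "\<And>t. t \<ge> 0 \<Longrightarrow> residual x u t = \<rho> t"
        using small[OF d ids \<rho>] by blast
      note st' = st[OF cl x0 u]
      have "norm (residual x u t) \<le> K2 * m"
        by (rule K2(2)[OF cl t]) (use st' t T_nonneg in \<open>auto intro: less_imp_le\<close>)
      also have "K2 * m < \<epsilon>" using K2 \<epsilon> by (simp add: m_def)
      finally show ?thesis using r[OF t] by simp
    qed
    moreover have "d / (2 * K1) > 0" using d K1 by simp
    ultimately show "\<exists>\<delta>>0. \<forall>\<rho>. ids \<rho> \<and> (\<forall>\<theta>\<in>{- T..<0}. norm (\<rho> \<theta>) < \<delta>) \<longrightarrow> (\<forall>t\<ge>0. norm (\<rho> t) < \<epsilon>)"
      by blast
  next
    obtain d where d: "d > 0"
      and at: "\<And>x u. cl x u \<Longrightarrow> norm (x 0) < d \<Longrightarrow> (\<And>\<theta>. \<theta> \<in> {- T..<0} \<Longrightarrow> norm (u \<theta>) < d) \<Longrightarrow>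
        (x \<longlongrightarrow> 0) at_top \<and> (u \<longlongrightarrow> 0) at_top"
      using assms unfolding closed_loop_asymptotically_stable_def by metis
    have "(\<rho> \<longlongrightarrow> 0) at_top"
      if ids: "ids \<rho>" and \<rho>: "\<And>\<theta>. \<theta> \<in> {- T..<0} \<Longrightarrow> norm (\<rho> \<theta>) < d / (2 * K1)" for \<rho>
    proof -
      obtain x u where cl: "cl x u" and x0: "norm (x 0) < d" and u: "\<And>\<theta>. \<theta> \<in> {- T..<0} \<Longrightarrow> norm (u \<theta>) < d"
        and r: "\<And>t. t \<ge> 0 \<Longrightarrow> residual x u t = \<rho> t"
        using small[OF d ids \<rho>] by blast
      have "(residual x u \<longlongrightarrow> 0) at_top"
        using at[OF cl x0 u] by (intro residual_tendsto_0 cl) auto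
      moreover have "\<forall>\<^sub>F t in at_top. residual x u t = \<rho> t"
        using eventually_ge_at_top[of 0] by eventually_elim (rule r)
      ultimately show ?thesis by (rule Lim_transform_eventually)
    qed
    moreover have "d / (2 * K1) > 0" using d K1 by simp
    ultimately show "\<exists>\<delta>>0. \<forall>\<rho>. ids \<rho> \<and> (\<forall>\<theta>\<in>{- T..<0}. norm (\<rho> \<theta>) < \<delta>) \<longrightarrow> (\<rho> \<longlongrightarrow> 0) at_top"
      by blast
  qed
qed

end

theorem proposition1:
  fixes A :: "real ^ 'n ^ 'n"
    and Bi :: "nat \<Rightarrow> real ^ 'm ^ 'n"
    and B :: "real ^ 'm ^ 'n"
    and F :: "real ^ 'n ^ 'm"
    and h :: "nat \<Rightarrow> real"
    and T :: real
  assumes "0 \<le> h 1" and "h 1 \<le> h 2" and "h 2 \<le> h 3"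
    and "T = h 1 + h 2 + h 3"
    and "B = mexp (- h 1 *\<^sub>R A) ** Bi 1 + mexp (- h 2 *\<^sub>R A) ** Bi 2 + mexp (- h 3 *\<^sub>R A) ** Bi 3"
    and "stabilizable A B"
    and "hurwitz (A + B ** F)"
  shows "closed_loop_asymptotically_stable A Bi h T B F \<longleftrightarrow>
         integral_delay_asymptotically_stable A T B F"
proof -
  have I: "{1..3} = {1, 2, 3 :: nat}" by auto
  interpret input_delay_system A Bi B F h T
  proof
    \<comment> \<open>The delays are nonnegative, so each is at most their sum.\<close>
    show "0 \<le> h i" "h i \<le> T" if "i \<in> {1..3}" for i
      using that assms(1-4) unfolding I by auto
    show "B = (\<Sum>i = 1..3. mexp (- h i *\<^sub>R A) ** Bi i)"
      unfolding I using assms(5) by (simp add: add.assoc)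
  qed (fact assms(7))
  show ?thesis
    using closed_loop_stable_imp_integral_delay_stable integral_delay_stable_imp_closed_loop_stable by blast
qed

end
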